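(* (a) Let $A$ be an $n$-by-$n$ complex matrix with $\|A\|=1$. Then $p_A=n_A$ (both possibly equal to $\infty$) if and only if either $A$ has a unitary part, or $A$ is unitarily similar to a direct sum $J_{k+1}\oplus B$, where $k=p_A<\infty$ and $B$ is an $(n-k-1)$-by-$(n-k-1)$ matrix with $B^{k+1}=0$. (b) If $A$ is an $n$-by-$n$ complex matrix with $\|A\|=1$ and $p_A=n_A$ (both possibly equal to $\infty$), then $w(A\otimes A)=w(A)$. The converse fails: there exists a square complex matrix $A$ with $\|A\|=1$ and $w(A\otimes A)=w(A)$ but $p_A\ne n_A$.
   Context: $\|\cdot\|$ is the operator norm; $w(X)=\max\{|\langle Xx,x\rangle| : \|x\|=1\}$ is the numerical radius; $\otimes$ is the tensor (Kronecker) product. $J_\ell$ is the $\ell$-by-$\ell$ nilpotent Jordan block (ones on the first superdiagonal, zeros elsewhere). For an $n$-by-$n$ matrix $A$: $p_A=\sup\{k\ge 1: \|A^k\|=\|A\|^k\}\in\{1,2,\dots\}\cup\{\infty\}$, and $n_A=\sup\{k\ge 1: A^k\ne 0\}$ if $A\ne 0$, $n_A=0$ if $A=0$. A contraction $A$ "has a unitary part" if it is unitarily similar to a direct sum $U\oplus A'$ with $U$ a unitary matrix of size at least 1 ($A'$ possibly absent). In (a), $B$ is allowed to be absent (size $0$). *)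

theory Defs
  imports
    "HOL-Library.Extended_Nat"
    "Jordan_Normal_Form.Jordan_Normal_Form"
    "Jordan_Normal_Form.Schur_Decomposition"
begin

definition vec_norm2 :: "complex vec \<Rightarrow> real" where
  "vec_norm2 x = sqrt (Re (x \<bullet>c x))"

(* The unit ball, rather than the unit sphere, makes the norm of the 0-by-0 matrix 0. *)
definition op_norm :: "complex mat \<Rightarrow> real" where
  "op_norm A = (SUP x \<in> {x \<in> carrier_vec (dim_col A). vec_norm2 x \<le> 1}. vec_norm2 (A *\<^sub>v x))"

(* The supremum is a maximum for every square matrix of size at least 1, since the unit
   sphere is compact; the value for the 0-by-0 matrix is irrelevant. *)
definition numerical_radius :: "complex mat \<Rightarrow> real" where
  "numerical_radius A =
     (SUP x \<in> {x \<in> carrier_vec (dim_col A). vec_norm2 x = 1}. cmod ((A *\<^sub>v x) \<bullet>c x))"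

definition kronecker :: "complex mat \<Rightarrow> complex mat \<Rightarrow> complex mat" where
  "kronecker A B =
     mat (dim_row A * dim_row B) (dim_col A * dim_col B)
       (\<lambda>(i, j). A $$ (i div dim_row B, j div dim_col B) * B $$ (i mod dim_row B, j mod dim_col B))"

definition norm_power_index :: "complex mat \<Rightarrow> enat" where
  "norm_power_index A = Sup {enat k | k. 1 \<le> k \<and> op_norm (A ^\<^sub>m k) = op_norm A ^ k}"

definition nonzero_power_index :: "complex mat \<Rightarrow> enat" where
  "nonzero_power_index A =
     (if A = 0\<^sub>m (dim_row A) (dim_col A) then 0
      else Sup {enat k | k. 1 \<le> k \<and> A ^\<^sub>m k \<noteq> 0\<^sub>m (dim_row A) (dim_col A)})"

definition unitary_mat :: "complex mat \<Rightarrow> bool" where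
  "unitary_mat U \<longleftrightarrow>
     square_mat U \<and> inverts_mat U (mat_adjoint U) \<and> inverts_mat (mat_adjoint U) U"

definition unitarily_similar :: "complex mat \<Rightarrow> complex mat \<Rightarrow> bool" where
  "unitarily_similar A B \<longleftrightarrow>
     (\<exists>U. unitary_mat U \<and> similar_mat_wit A B U (mat_adjoint U))"

(* The summand A' may be the 0-by-0 matrix. *)
definition has_unitary_part :: "complex mat \<Rightarrow> bool" where
  "has_unitary_part A \<longleftrightarrow>
     (\<exists>U A'. unitary_mat U \<and> 1 \<le> dim_row U \<and> square_mat A' \<and>
        unitarily_similar A (diag_block_mat [U, A']))"

end

(* For a contraction T, Cauchy-Schwarz for the form [u, v] = <u, v> - <T u, T v> is the main tool: if
   ||T x|| = ||x|| it gives <T x, T y> = <x, y> for all y.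

   If p_A = n_A = infinity, then ||A^k|| = 1 for all k, so the spectral radius is 1 and A has an
   eigenvector x with unimodular eigenvalue; the form shows that the complement of x is invariant, which
   splits off a 1-by-1 unitary. If p_A = n_A = k is finite, choose a unit x with ||A^k x|| = 1; as
   A^(k+1) = 0, the vectors x, A x, ..., A^k x are orthonormal and span a reducing subspace on which A
   is J_{k+1}.

   For (b), a contraction T with T^(k+1) = 0 and ||T^k|| = 1 satisfies w(T) = w(J_{k+1}). With A, also
   the Kronecker square of A is of this kind, with the same k. In the infinite case both numerical radii are 1. *)

theory Submission
  imports Defs "Jordan_Normal_Form.Spectral_Radius"
begin

subsection \<open>The Hermitian inner product\<close>

text \<open>Knowing that a power of T has norm 1 helps only once a unit vector attains it. This is
  obtained algebraically instead of by compactness: if \<open>1 - mat_adjoint T * T\<close> were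
  invertible, the norm of T would be strictly below 1, so there is a null vector, and T preserves
  its norm. Spectral radius 1 comes from rescaling: were it smaller, some multiple d T with d > 1
  would still have spectral radius below 1 and hence bounded powers, while its k-th power has norm
  d^k. Orthogonality of the orbit of x rests on the powers of T being isometric along it as long as
  the exponents stay at most k: applying the power that kills the later of two vectors keeps their
  inner product and makes it 0. The delicate half of w(T) = w(J_{k+1}) is the upper bound, since T
  may act in any way off the orbit. Every unit vector y is therefore compared with a real unit
  vector for the Jordan block, whose squared entries are the successive losses of squared norm along
  y, T y, T^2 y, and so on.\<close>

lemma cscalar_prod_eq_sum:
  fixes x y :: "complex vec"
  shows "x \<bullet>c y = (\<Sum>i<dim_vec y. x $ i * cnj (y $ i))"
  by (auto simp: scalar_prod_def lessThan_atLeast0 intro!: sum.cong)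

lemma cscalar_prod_swap:
  fixes x y :: "complex vec"
  assumes "x \<in> carrier_vec n" "y \<in> carrier_vec n"
  shows "y \<bullet>c x = cnj (x \<bullet>c y)"
  using assms by (simp add: cscalar_prod_eq_sum mult.commute)

lemma cscalar_prod_add_left:
  fixes x y z :: "complex vec"
  assumes "x \<in> carrier_vec n" "y \<in> carrier_vec n" "z \<in> carrier_vec n"
  shows "(x + y) \<bullet>c z = x \<bullet>c z + y \<bullet>c z"
  using assms by (simp add: cscalar_prod_eq_sum sum.distrib ring_distribs)

lemma cscalar_prod_smult_left:
  fixes x y :: "complex vec"
  assumes "x \<in> carrier_vec n" "y \<in> carrier_vec n"
  shows "(c \<cdot>\<^sub>v x) \<bullet>c y = c * (x \<bullet>c y)"
  using assms by (simp add: cscalar_prod_eq_sum sum_distrib_left mult.assoc)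

lemma cscalar_prod_add_right:
  fixes x y z :: "complex vec"
  assumes "x \<in> carrier_vec n" "y \<in> carrier_vec n" "z \<in> carrier_vec n"
  shows "x \<bullet>c (y + z) = x \<bullet>c y + x \<bullet>c z"
  using assms by (simp add: cscalar_prod_eq_sum sum.distrib ring_distribs)

lemma cscalar_prod_smult_right:
  fixes x y :: "complex vec"
  assumes "x \<in> carrier_vec n" "y \<in> carrier_vec n"
  shows "x \<bullet>c (c \<cdot>\<^sub>v y) = cnj c * (x \<bullet>c y)"
  using assms by (simp add: cscalar_prod_eq_sum sum_distrib_left mult_ac)

lemma cscalar_prod_self_eq_sum:
  fixes x :: "complex vec"
  shows "x \<bullet>c x = of_real (\<Sum>i<dim_vec x. (cmod (x $ i))\<^sup>2)"
  by (simp add: cscalar_prod_eq_sum complex_norm_square del: of_real_power)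

lemma vec_norm2_sq: "(vec_norm2 x)\<^sup>2 = (\<Sum>i<dim_vec x. (cmod (x $ i))\<^sup>2)"
  by (simp add: vec_norm2_def cscalar_prod_self_eq_sum sum_nonneg)

lemma cscalar_prod_self: "x \<bullet>c x = of_real ((vec_norm2 x)\<^sup>2)"
  by (simp only: vec_norm2_sq cscalar_prod_self_eq_sum)

lemma vec_norm2_nonneg [simp]: "0 \<le> vec_norm2 x"
  by (simp add: vec_norm2_def cscalar_prod_self_eq_sum sum_nonneg)

lemma vec_norm2_zero [simp]: "vec_norm2 (0\<^sub>v n) = 0"
  by (simp add: vec_norm2_def cscalar_prod_eq_sum)

lemma vec_norm2_eq_0_iff:
  assumes "x \<in> carrier_vec n"
  shows "vec_norm2 x = 0 \<longleftrightarrow> x = 0\<^sub>v n"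
  using conjugate_square_eq_0_vec[OF assms] cscalar_prod_self[of x] by simp

lemma vec_norm2_smult: "vec_norm2 (c \<cdot>\<^sub>v x) = cmod c * vec_norm2 x"
proof -
  have "(vec_norm2 (c \<cdot>\<^sub>v x))\<^sup>2 = (cmod c * vec_norm2 x)\<^sup>2"
    by (simp add: vec_norm2_sq power_mult_distrib norm_mult sum_distrib_left)
  then show ?thesis by (simp add: power2_eq_iff_nonneg)
qed

lemma normalize_vec:
  assumes "x \<in> carrier_vec n" "x \<noteq> 0\<^sub>v n"
  shows "vec_norm2 (complex_of_real (1 / vec_norm2 x) \<cdot>\<^sub>v x) = 1"
  using assms vec_norm2_eq_0_iff[of x n] by (simp add: vec_norm2_smult norm_divide)

lemma zero_mat_mult_vec [simp]:
  fixes x :: "complex vec"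
  shows "x \<in> carrier_vec m \<Longrightarrow> 0\<^sub>m n m *\<^sub>v x = 0\<^sub>v n"
  by (intro eq_vecI) auto

lemma mat_mult_zero_vec [simp]:
  fixes A :: "complex mat"
  shows "A \<in> carrier_mat n m \<Longrightarrow> A *\<^sub>v 0\<^sub>v m = 0\<^sub>v n"
  by (intro eq_vecI) auto

text \<open>The hypothesis is the value of a semidefinite form at a vector x - s y, so this is the
  Cauchy-Schwarz inequality with degenerate forms allowed. If q = 0 the expression is affine along
  the multiples of z, hence unbounded below unless z = 0.\<close>

lemma semidefinite_discriminant:
  fixes p q :: real and z :: complex
  assumes "q \<ge> 0" and form: "\<And>s. p - 2 * Re (cnj s * z) + (cmod s)\<^sup>2 * q \<ge> 0"
  shows "(cmod z)\<^sup>2 \<le> p * q"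
proof (cases "q = 0")
  case False
  then have q: "q > 0" using assms by simp
  have c: "Re (cnj z * z) = (cmod z)\<^sup>2"
    by (metis Re_complex_of_real complex_norm_square mult.commute of_real_power)
  \<comment> \<open>The quadratic in s takes its minimum at s = z / q.\<close>
  have "0 \<le> p - 2 * Re (cnj (z / q) * z) + (cmod (z / q))\<^sup>2 * q" by (rule form)
  also have "\<dots> = p - (cmod z)\<^sup>2 / q"
    using q c by (simp add: norm_divide power_divide field_simps power2_eq_square)
  finally show ?thesis using q by (simp add: field_simps)
next
  case True
  have "Re (cnj (of_real t * z) * z) = t * (cmod z)\<^sup>2" for t
    by (simp add: cmod_power2 algebra_simps power2_eq_square[of "Re z"] power2_eq_square[of "Im z"])
  then have *: "0 \<le> p - 2 * (t * (cmod z)\<^sup>2)" for t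
    using form[of "of_real t * z"] True by simp
  have "cmod z = 0"
  proof (rule ccontr)
    assume z: "cmod z \<noteq> 0"
    \<comment> \<open>The multiple is chosen so that the value becomes p - 2 (p + 1), which is
      negative because p itself, the value at 0, is nonnegative.\<close>
    have "0 \<le> p - 2 * (((p + 1) / (cmod z)\<^sup>2) * (cmod z)\<^sup>2)" by (rule *)
    also have "\<dots> = - p - 2" using z by simp
    finally show False using *[of 0] by simp
  qed
  then show ?thesis using True by simp
qed

subsection \<open>Contractions and the defect form\<close>

text \<open>Phrased vector by vector, so that powers and Kronecker products are seen to be
  contractions without handling a supremum.\<close>

definition contraction :: "nat \<Rightarrow> complex mat \<Rightarrow> bool" where
  "contraction n T \<longleftrightarrow> T \<in> carrier_mat n n \<and> (\<forall>x \<in> carrier_vec n. vec_norm2 (T *\<^sub>v x) \<le> vec_norm2 x)"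

lemma contraction_carrier: "contraction n T \<Longrightarrow> T \<in> carrier_mat n n"
  by (simp add: contraction_def)

lemma contractionD: "contraction n T \<Longrightarrow> x \<in> carrier_vec n \<Longrightarrow> vec_norm2 (T *\<^sub>v x) \<le> vec_norm2 x"
  by (simp add: contraction_def)

text \<open>The sesquilinear form of \<open>1 - mat_adjoint T * T\<close>, the square of the defect
  operator of a contraction; it is positive semidefinite but usually degenerate.\<close>

definition defect_form :: "complex mat \<Rightarrow> complex vec \<Rightarrow> complex vec \<Rightarrow> complex" where
  "defect_form T x y = x \<bullet>c y - (T *\<^sub>v x) \<bullet>c (T *\<^sub>v y)"

lemma defect_form_self: "defect_form T x x = of_real ((vec_norm2 x)\<^sup>2 - (vec_norm2 (T *\<^sub>v x))\<^sup>2)"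
  by (simp add: defect_form_def cscalar_prod_self)

lemma defect_form_Cauchy_Schwarz:
  assumes T: "contraction n T" and x: "x \<in> carrier_vec n" and y: "y \<in> carrier_vec n"
  shows "(cmod (defect_form T x y))\<^sup>2
    \<le> ((vec_norm2 x)\<^sup>2 - (vec_norm2 (T *\<^sub>v x))\<^sup>2) * ((vec_norm2 y)\<^sup>2 - (vec_norm2 (T *\<^sub>v y))\<^sup>2)"
    (is "_ \<le> ?p * ?q")
proof (rule semidefinite_discriminant)
  note TC = contraction_carrier[OF T]
  show "0 \<le> ?q" using contractionD[OF T y] by (simp add: power_mono)
  fix s
  let ?w = "x + (- s) \<cdot>\<^sub>v y"
  have w: "?w \<in> carrier_vec n" using x y by simp
  have Tx: "T *\<^sub>v x \<in> carrier_vec n" "T *\<^sub>v y \<in> carrier_vec n" using TC x y by auto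
  have Tw: "T *\<^sub>v ?w = T *\<^sub>v x + (- s) \<cdot>\<^sub>v (T *\<^sub>v y)"
    using mult_add_distrib_mat_vec[OF TC x, of "(- s) \<cdot>\<^sub>v y"] mult_mat_vec[OF TC y, of "- s"] y by simp
  \<comment> \<open>Proved for arbitrary vectors because it is needed twice: for x and y, and for
    their images under T. The difference of the two expansions is the expansion of the form.\<close>
  have expand: "(a + (- s) \<cdot>\<^sub>v b) \<bullet>c (a + (- s) \<cdot>\<^sub>v b)
      = a \<bullet>c a - cnj s * (a \<bullet>c b) - cnj (cnj s * (a \<bullet>c b)) + of_real ((cmod s)\<^sup>2) * (b \<bullet>c b)"
    if a: "a \<in> carrier_vec n" and b: "b \<in> carrier_vec n" for a b :: "complex vec"
    unfolding complex_norm_square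
    using a b cscalar_prod_swap[OF a b]
    by (simp add: cscalar_prod_add_left[of _ n] cscalar_prod_add_right[of _ n]
        cscalar_prod_smult_left[of _ n] cscalar_prod_smult_right[of _ n] algebra_simps)
  have "defect_form T ?w ?w = defect_form T x x - cnj s * defect_form T x y
     - cnj (cnj s * defect_form T x y) + of_real ((cmod s)\<^sup>2) * defect_form T y y"
    unfolding defect_form_def Tw expand[OF x y] expand[OF Tx] by (simp add: algebra_simps)
  then have "Re (defect_form T ?w ?w) = ?p - 2 * Re (cnj s * defect_form T x y) + (cmod s)\<^sup>2 * ?q"
    unfolding defect_form_self by simp
  moreover have "0 \<le> Re (defect_form T ?w ?w)"
    using contractionD[OF T w] by (simp add: defect_form_self power_mono)
  ultimately show "0 \<le> ?p - 2 * Re (cnj s * defect_form T x y) + (cmod s)\<^sup>2 * ?q" by simp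
qed

lemma contraction_zero: "contraction n (0\<^sub>m n n)"
  by (simp add: contraction_def)

text \<open>The defect form of the zero matrix is the inner product itself.\<close>

lemma cscalar_prod_Cauchy_Schwarz:
  assumes "x \<in> carrier_vec n" "y \<in> carrier_vec n"
  shows "cmod (x \<bullet>c y) \<le> vec_norm2 x * vec_norm2 y"
proof -
  have "(cmod (x \<bullet>c y))\<^sup>2 \<le> (vec_norm2 x)\<^sup>2 * (vec_norm2 y)\<^sup>2"
    using defect_form_Cauchy_Schwarz[OF contraction_zero assms] assms
    by (simp add: defect_form_def)
  then show ?thesis by (simp add: power_mult_distrib[symmetric] power2_le_iff_abs_le)
qed

text \<open>A vector whose norm is preserved is isotropic for a semidefinite form, hence orthogonal
  to everything with respect to it.\<close>

lemma contraction_isometric_vec: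
  assumes T: "contraction n T" and x: "x \<in> carrier_vec n" and y: "y \<in> carrier_vec n"
    and "vec_norm2 (T *\<^sub>v x) = vec_norm2 x"
  shows "(T *\<^sub>v x) \<bullet>c (T *\<^sub>v y) = x \<bullet>c y"
  using defect_form_Cauchy_Schwarz[OF T x y] assms(4) by (simp add: defect_form_def)

lemma contraction_pow: "contraction n T \<Longrightarrow> contraction n (T ^\<^sub>m k)"
proof (induction k)
  case (Suc k)
  note TC = contraction_carrier[OF Suc.prems]
  have "vec_norm2 (T ^\<^sub>m Suc k *\<^sub>v x) \<le> vec_norm2 x" if x: "x \<in> carrier_vec n" for x
  proof -
    have Tx: "T *\<^sub>v x \<in> carrier_vec n" using TC x by simp
    have "T ^\<^sub>m Suc k *\<^sub>v x = T ^\<^sub>m k *\<^sub>v (T *\<^sub>v x)"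
      using TC x by (simp add: assoc_mult_mat_vec[of _ n n _ n])
    then show ?thesis using contractionD[OF Suc.IH[OF Suc.prems] Tx] contractionD[OF Suc.prems x] by simp
  qed
  then show ?case using pow_carrier_mat[OF TC, of "Suc k"] unfolding contraction_def by blast
qed (auto simp: contraction_def)

section \<open>Boundedness and the operator norm\<close>

text \<open>The constant is the Frobenius norm. Some finite bound is needed before the suprema
  defining \<open>op_norm\<close> and \<open>numerical_radius\<close> say anything.\<close>

lemma mult_mat_vec_norm_bound:
  assumes A: "A \<in> carrier_mat n n"
  obtains K where "K \<ge> 0" "\<And>x. x \<in> carrier_vec n \<Longrightarrow> vec_norm2 (A *\<^sub>v x) \<le> K * vec_norm2 x"
proof
  let ?K = "sqrt (\<Sum>i<n. (vec_norm2 (conjugate (row A i)))\<^sup>2)"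
  show "?K \<ge> 0" by (simp add: sum_nonneg)
  fix x :: "complex vec" assume x: "x \<in> carrier_vec n"
  have "(vec_norm2 (A *\<^sub>v x))\<^sup>2 = (\<Sum>i<n. (cmod (x \<bullet>c conjugate (row A i)))\<^sup>2)"
    using A x comm_scalar_prod[of _ n x] by (auto simp: vec_norm2_sq intro!: sum.cong)
  also have "\<dots> \<le> (\<Sum>i<n. (vec_norm2 x * vec_norm2 (conjugate (row A i)))\<^sup>2)"
    using A x by (intro sum_mono power_mono cscalar_prod_Cauchy_Schwarz[of _ n]) auto
  also have "\<dots> = (?K * vec_norm2 x)\<^sup>2"
    by (simp add: power_mult_distrib sum_distrib_left sum_nonneg mult.commute)
  finally show "vec_norm2 (A *\<^sub>v x) \<le> ?K * vec_norm2 x"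
    by (rule power2_le_imp_le) (simp add: sum_nonneg)
qed

lemma op_norm_upper:
  assumes A: "A \<in> carrier_mat n n" and x: "x \<in> carrier_vec n"
  shows "vec_norm2 (A *\<^sub>v x) \<le> op_norm A * vec_norm2 x"
proof (cases "x = 0\<^sub>v n")
  case True
  then show ?thesis using A by simp
next
  case False
  let ?S = "{x \<in> carrier_vec (dim_col A). vec_norm2 x \<le> 1}"
  obtain K where K: "K \<ge> 0" "\<And>x. x \<in> carrier_vec n \<Longrightarrow> vec_norm2 (A *\<^sub>v x) \<le> K * vec_norm2 x"
    using mult_mat_vec_norm_bound[OF A] by metis
  have bdd: "bdd_above ((\<lambda>x. vec_norm2 (A *\<^sub>v x)) ` ?S)"
  proof (rule bdd_aboveI2)
    fix x assume "x \<in> ?S"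
    then show "vec_norm2 (A *\<^sub>v x) \<le> K"
      using A K(1) K(2)[of x] mult_left_le[of "vec_norm2 x" K] by auto
  qed
  let ?u = "complex_of_real (1 / vec_norm2 x) \<cdot>\<^sub>v x"
  have "?u \<in> ?S" using A x normalize_vec[OF x False] by simp
  then have "vec_norm2 (A *\<^sub>v ?u) \<le> op_norm A"
    unfolding op_norm_def using bdd by (rule cSUP_upper)
  moreover have "vec_norm2 x > 0" using x False vec_norm2_eq_0_iff[of x n] vec_norm2_nonneg[of x] by linarith
  ultimately show ?thesis
    using mult_mat_vec[OF A x, of "complex_of_real (1 / vec_norm2 x)"] by (simp add: vec_norm2_smult norm_divide field_simps)
qed

lemma op_norm_least:
  assumes A: "A \<in> carrier_mat n n" and "K \<ge> 0"
    and "\<And>x. x \<in> carrier_vec n \<Longrightarrow> vec_norm2 (A *\<^sub>v x) \<le> K * vec_norm2 x"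
  shows "op_norm A \<le> K"
  unfolding op_norm_def
proof (rule cSUP_least)
  show "{x \<in> carrier_vec (dim_col A). vec_norm2 x \<le> 1} \<noteq> {}" by (auto intro!: exI[of _ "0\<^sub>v (dim_col A)"])
next
  fix x assume "x \<in> {x \<in> carrier_vec (dim_col A). vec_norm2 x \<le> 1}"
  then show "vec_norm2 (A *\<^sub>v x) \<le> K"
    using A \<open>K \<ge> 0\<close> assms(3)[of x] mult_left_le[of "vec_norm2 x" K] by auto
qed

lemma op_norm_1_contraction:
  assumes "A \<in> carrier_mat n n" "op_norm A = 1" shows "contraction n A"
  using op_norm_upper[OF assms(1)] assms by (simp add: contraction_def)

lemma op_norm_eq_1:
  assumes T: "contraction n T" and x: "x \<in> carrier_vec n" "vec_norm2 x = 1" "vec_norm2 (T *\<^sub>v x) = 1"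
  shows "op_norm T = 1"
proof (rule antisym)
  show "op_norm T \<le> 1" using T by (intro op_norm_least[of _ n]) (auto simp: contraction_def)
  show "1 \<le> op_norm T" using op_norm_upper[OF contraction_carrier[OF T] x(1)] x by simp
qed

section \<open>The adjoint, and attainment of the operator norm\<close>

lemma mat_adjoint_carrier: "A \<in> carrier_mat n m \<Longrightarrow> mat_adjoint A \<in> carrier_mat m n"
  by (auto simp: mat_adjoint_def mat_of_rows_def)

lemma mat_adjoint_dim [simp]: "dim_row (mat_adjoint A) = dim_col A" "dim_col (mat_adjoint A) = dim_row A"
  for A :: "complex mat"
  by (auto simp: mat_adjoint_def mat_of_rows_def)

lemma mat_adjoint_index:
  fixes A :: "complex mat"
  shows "i < dim_col A \<Longrightarrow> j < dim_row A \<Longrightarrow> mat_adjoint A $$ (i, j) = cnj (A $$ (j, i))"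
  by (simp add: mat_adjoint_def mat_of_rows_def)

lemma row_mat_adjoint:
  fixes A :: "complex mat"
  shows "i < dim_col A \<Longrightarrow> row (mat_adjoint A) i = conjugate (col A i)"
  by (auto simp: mat_adjoint_index)

lemma mat_adjoint_cscalar_prod:
  fixes A :: "complex mat"
  assumes A: "A \<in> carrier_mat n m" and x: "x \<in> carrier_vec n" and y: "y \<in> carrier_vec m"
  shows "(mat_adjoint A *\<^sub>v x) \<bullet>c y = x \<bullet>c (A *\<^sub>v y)"
proof -
  have "(mat_adjoint A *\<^sub>v x) \<bullet>c y = (\<Sum>j<m. \<Sum>i<n. cnj (A $$ (i, j)) * x $ i * cnj (y $ j))"
    using A x y
    by (auto simp: cscalar_prod_eq_sum row_mat_adjoint scalar_prod_def lessThan_atLeast0 sum_distrib_right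
        intro!: sum.cong)
  also have "\<dots> = (\<Sum>i<n. \<Sum>j<m. cnj (A $$ (i, j)) * x $ i * cnj (y $ j))"
    by (rule sum.swap)
  also have "\<dots> = x \<bullet>c (A *\<^sub>v y)"
    using A x y
    by (auto simp: cscalar_prod_eq_sum scalar_prod_def lessThan_atLeast0 sum_distrib_left mult_ac
        intro!: sum.cong)
  finally show ?thesis .
qed

text \<open>If \<open>1 - T\<^sup>*T\<close> had an inverse \<open>C\<close>, the Cauchy-Schwarz inequality for the defect form, applied
  to \<open>x\<close> and \<open>C x\<close>, would bound the form below by a positive multiple of \<open>\<parallel>x\<parallel>\<^sup>2\<close>.\<close>
lemma contraction_op_norm_attained:
  assumes T: "contraction n T" and norm: "op_norm T = 1"
  obtains x where "x \<in> carrier_vec n" "vec_norm2 x = 1" "vec_norm2 (T *\<^sub>v x) = 1"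
proof -
  note TC = contraction_carrier[OF T]
  let ?D = "1\<^sub>m n - mat_adjoint T * T"
  have aC: "mat_adjoint T \<in> carrier_mat n n" using mat_adjoint_carrier[OF TC] .
  have D: "?D \<in> carrier_mat n n" by (intro minus_carrier_mat mult_carrier_mat[OF aC TC])
  have form: "(?D *\<^sub>v x) \<bullet>c y = defect_form T x y" if x: "x \<in> carrier_vec n" and y: "y \<in> carrier_vec n" for x y
  proof -
    have Tx: "T *\<^sub>v x \<in> carrier_vec n" "mat_adjoint T *\<^sub>v (T *\<^sub>v x) \<in> carrier_vec n" using TC aC x by auto
    have "?D *\<^sub>v x = x - mat_adjoint T *\<^sub>v (T *\<^sub>v x)"
      using minus_mult_distrib_mat_vec[of "1\<^sub>m n" n n "mat_adjoint T * T" x] mult_carrier_mat[OF aC TC] x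
        assoc_mult_mat_vec[OF aC TC x] by simp
    then have "(?D *\<^sub>v x) \<bullet>c y = x \<bullet>c y - (mat_adjoint T *\<^sub>v (T *\<^sub>v x)) \<bullet>c y"
      using minus_scalar_prod_distrib[OF x Tx(2), of "conjugate y"] y by simp
    then show ?thesis using mat_adjoint_cscalar_prod[OF TC Tx(1) y] by (simp add: defect_form_def)
  qed
  have "det ?D = 0"
  proof (rule ccontr)
    assume "det ?D \<noteq> 0"
    then obtain C where C: "C \<in> carrier_mat n n" "?D * C = 1\<^sub>m n"
      using det_non_zero_imp_unit[OF D, of "()"] D by (auto simp: Units_def ring_mat_def)
    obtain K where K: "K \<ge> 0" "\<And>x. x \<in> carrier_vec n \<Longrightarrow> vec_norm2 (C *\<^sub>v x) \<le> K * vec_norm2 x"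
      using mult_mat_vec_norm_bound[OF C(1)] by metis
    have main: "(vec_norm2 x)\<^sup>2 \<le> ((vec_norm2 x)\<^sup>2 - (vec_norm2 (T *\<^sub>v x))\<^sup>2) * K"
      if x: "x \<in> carrier_vec n" and nz: "vec_norm2 x \<noteq> 0" for x
    proof -
      let ?y = "C *\<^sub>v x" and ?p = "(vec_norm2 x)\<^sup>2 - (vec_norm2 (T *\<^sub>v x))\<^sup>2"
      have y: "?y \<in> carrier_vec n" using C x by simp
      have Dy: "?D *\<^sub>v ?y = x" using assoc_mult_mat_vec[OF D C(1) x] C x by simp
      have p: "?p \<ge> 0" using contractionD[OF T x] by (simp add: power_mono)
      have "defect_form T ?y x = of_real ((vec_norm2 x)\<^sup>2)"
        using form[OF y x] Dy by (simp add: cscalar_prod_self)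
      then have "(cmod (defect_form T ?y x))\<^sup>2 = ((vec_norm2 x)\<^sup>2)\<^sup>2" by (simp add: norm_power)
      moreover have "cmod (defect_form T ?y ?y) \<le> K * (vec_norm2 x)\<^sup>2"
      proof -
        have "cmod (x \<bullet>c ?y) \<le> vec_norm2 x * vec_norm2 ?y" by (rule cscalar_prod_Cauchy_Schwarz[OF x y])
        also have "\<dots> \<le> vec_norm2 x * (K * vec_norm2 x)" by (intro mult_left_mono K x) simp
        finally show ?thesis using form[OF y y] Dy by (simp add: power2_eq_square mult_ac)
      qed
      then have "(vec_norm2 ?y)\<^sup>2 - (vec_norm2 (T *\<^sub>v ?y))\<^sup>2 \<le> K * (vec_norm2 x)\<^sup>2"
        unfolding defect_form_self norm_of_real by linarith
      ultimately have "((vec_norm2 x)\<^sup>2)\<^sup>2 \<le> K * (vec_norm2 x)\<^sup>2 * ?p"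
        using order_trans[OF defect_form_Cauchy_Schwarz[OF T y x] mult_right_mono[OF _ p]] by simp
      then have "(vec_norm2 x)\<^sup>2 * (vec_norm2 x)\<^sup>2 \<le> (vec_norm2 x)\<^sup>2 * (?p * K)"
        by (simp add: power2_eq_square mult_ac)
      then show ?thesis using nz by (subst (asm) mult_le_cancel_left_pos) auto
    qed
    \<comment> \<open>Rearranging \<open>main\<close> bounds the quotient of the squared norms of T
      x and x. Using K + 1 in place of K keeps the denominator positive when K = 0 and makes L^2 = 1
      - 1 / (K + 1) lie in [0, 1).\<close>
    define L where "L = sqrt (1 - 1 / (K + 1))"
    have L: "0 \<le> L" "L < 1" using K(1) by (auto simp: L_def)
    have "op_norm T \<le> L"
    proof (rule op_norm_least[OF TC L(1)])
      fix x :: "complex vec" assume x: "x \<in> carrier_vec n"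
      show "vec_norm2 (T *\<^sub>v x) \<le> L * vec_norm2 x"
      proof (cases "vec_norm2 x = 0")
        case True then show ?thesis using contractionD[OF T x] by simp
      next
        case False
        let ?a = "(vec_norm2 x)\<^sup>2" and ?b = "(vec_norm2 (T *\<^sub>v x))\<^sup>2"
        have "?b \<le> ?a" using contractionD[OF T x] by (simp add: power_mono)
        then have "?a \<le> (?a - ?b) * (K + 1)" using main[OF x False] unfolding distrib_left mult_1_right by linarith
        then have "?a / (K + 1) \<le> ?a - ?b" using K(1) by (subst pos_divide_le_eq) auto
        then have "?b \<le> (1 - 1 / (K + 1)) * ?a" by (simp add: left_diff_distrib)
        also have "\<dots> = (L * vec_norm2 x)\<^sup>2" using K(1) by (simp add: L_def power_mult_distrib)
        finally show ?thesis using L(1) by (auto intro: power2_le_imp_le)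
      qed
    qed
    then show False using norm L by simp
  qed
  then obtain v where v: "v \<in> carrier_vec n" "v \<noteq> 0\<^sub>v n" "?D *\<^sub>v v = 0\<^sub>v n"
    using det_0_iff_vec_prod_zero_field[OF D] by auto
  have "defect_form T v v = 0" using form[OF v(1) v(1)] v by simp
  then have eq: "vec_norm2 (T *\<^sub>v v) = vec_norm2 v"
    unfolding defect_form_self of_real_eq_0_iff by (simp add: power2_eq_iff_nonneg)
  let ?u = "complex_of_real (1 / vec_norm2 v) \<cdot>\<^sub>v v"
  have "vec_norm2 (T *\<^sub>v ?u) = 1"
    using normalize_vec[OF v(1,2)] eq by (simp only: mult_mat_vec[OF TC v(1)] vec_norm2_smult)
  then show thesis using that[of ?u] v normalize_vec[OF v(1,2)] by simp
qed

section \<open>Powers applied to vectors, and underdetermined systems\<close>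

lemma pow_add_mult_vec:
  fixes A :: "complex mat"
  assumes A: "A \<in> carrier_mat n n" and x: "x \<in> carrier_vec n"
  shows "A ^\<^sub>m (i + j) *\<^sub>v x = A ^\<^sub>m i *\<^sub>v (A ^\<^sub>m j *\<^sub>v x)"
  using x
proof (induction j arbitrary: x)
  case 0
  then show ?case using A by simp
next
  case (Suc j)
  note pc = pow_carrier_mat[OF A]
  have Ax: "A *\<^sub>v x \<in> carrier_vec n" using A Suc.prems by simp
  have s: "A ^\<^sub>m Suc l *\<^sub>v x = A ^\<^sub>m l *\<^sub>v (A *\<^sub>v x)" for l
    using assoc_mult_mat_vec[OF pc A Suc.prems] by simp
  show ?case using Suc.IH[OF Ax] s[of "i + j"] s[of j] by simp
qed

text \<open>Powers are built by multiplying on the right; orbits need the new factor on the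
  left.\<close>

lemma pow_Suc_mult_vec:
  fixes A :: "complex mat"
  assumes A: "A \<in> carrier_mat n n" and x: "x \<in> carrier_vec n"
  shows "A ^\<^sub>m Suc k *\<^sub>v x = A *\<^sub>v (A ^\<^sub>m k *\<^sub>v x)"
  using pow_add_mult_vec[OF assms, of 1 k] A by simp

text \<open>Fill the system up to a square one. Row m can be made zero because m < n, so the
  determinant vanishes; any rows after it are arbitrary.\<close>

lemma wide_system_solution:
  fixes M :: "nat \<Rightarrow> nat \<Rightarrow> complex"
  assumes "m < n"
  obtains x where "x \<in> carrier_vec n" "x \<noteq> 0\<^sub>v n" "\<And>i. i < m \<Longrightarrow> (\<Sum>j<n. M i j * x $ j) = 0"
proof -
  let ?R = "\<lambda>i. if i = m then 0\<^sub>v n else vec n (M i)"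
  let ?A = "mat\<^sub>r n n ?R"
  have A: "?A \<in> carrier_mat n n" by simp
  have "det ?A = 0" by (rule det_row_0) (use assms in auto)
  then obtain x where x: "x \<in> carrier_vec n" "x \<noteq> 0\<^sub>v n" "?A *\<^sub>v x = 0\<^sub>v n"
    using det_0_iff_vec_prod_zero_field[OF A] by auto
  have "(\<Sum>j<n. M i j * x $ j) = 0" if "i < m" for i
  proof -
    have "(?A *\<^sub>v x) $ i = 0" using x(3) that assms by simp
    then show ?thesis using that assms x(1) by (simp add: scalar_prod_def lessThan_atLeast0)
  qed
  then show thesis using that x by blast
qed

subsection \<open>Orthonormal families and reducing subspaces\<close>

text \<open>Only the first m members count, so that a family can be prolonged by updating a single
  value of the function.\<close>

definition orthonormal :: "nat \<Rightarrow> nat \<Rightarrow> (nat \<Rightarrow> complex vec) \<Rightarrow> bool" where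
  "orthonormal n m v \<longleftrightarrow> (\<forall>i<m. v i \<in> carrier_vec n) \<and>
     (\<forall>i<m. \<forall>j<m. v i \<bullet>c v j = (if i = j then 1 else 0))"

definition frame_mat :: "nat \<Rightarrow> nat \<Rightarrow> (nat \<Rightarrow> complex vec) \<Rightarrow> complex mat" where
  "frame_mat n m v = mat n m (\<lambda>(i, j). v j $ i)"

lemma frame_mat_carrier [simp]: "frame_mat n m v \<in> carrier_mat n m"
  by (simp add: frame_mat_def)

lemma frame_mat_dim [simp]: "dim_row (frame_mat n m v) = n" "dim_col (frame_mat n m v) = m"
  by (simp_all add: frame_mat_def)

lemma col_frame_mat: "j < m \<Longrightarrow> v j \<in> carrier_vec n \<Longrightarrow> col (frame_mat n m v) j = v j"
  by (intro eq_vecI) (auto simp: frame_mat_def)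

text \<open>Serves three purposes: with A the identity it gives the Gram matrix, with m = n a change
  of orthonormal basis, and for general m the compression of A to the span of the family.\<close>

lemma adjoint_frame_mat_mult_index:
  assumes v: "\<And>j. j < m \<Longrightarrow> v j \<in> carrier_vec n" and A: "A \<in> carrier_mat n n" and i: "i < m" "j < m"
  shows "(mat_adjoint (frame_mat n m v) * A * frame_mat n m v) $$ (i, j) = (A *\<^sub>v v j) \<bullet>c v i"
proof -
  let ?V = "frame_mat n m v"
  have aV: "mat_adjoint ?V \<in> carrier_mat m n" by (rule mat_adjoint_carrier) simp
  have "(mat_adjoint ?V * A * ?V) $$ (i, j) = (mat_adjoint ?V * (A * ?V)) $$ (i, j)"
    using assoc_mult_mat[OF aV A frame_mat_carrier] by simp
  also have "\<dots> = conjugate (v i) \<bullet> col (A * ?V) j"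
    using A i v by (simp add: row_mat_adjoint col_frame_mat)
  also have "col (A * ?V) j = A *\<^sub>v v j"
    using A i v[OF i(2)] by (intro eq_vecI) (auto simp: col_frame_mat)
  also have "conjugate (v i) \<bullet> (A *\<^sub>v v j) = (A *\<^sub>v v j) \<bullet>c v i"
    using conjugate_vec_sprod_comm[of "A *\<^sub>v v j" n "v i"] A i v by simp
  finally show ?thesis .
qed

lemma orthonormal_frame_mat:
  assumes "orthonormal n m v"
  shows "mat_adjoint (frame_mat n m v) * frame_mat n m v = 1\<^sub>m m"
proof -
  have v: "\<And>j. j < m \<Longrightarrow> v j \<in> carrier_vec n" using assms by (simp add: orthonormal_def)
  have a: "mat_adjoint (frame_mat n m v) \<in> carrier_mat m n" by (rule mat_adjoint_carrier) simp
  show ?thesis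
  proof (intro eq_matI)
    fix i j assume ij: "i < dim_row (1\<^sub>m m :: complex mat)" "j < dim_col (1\<^sub>m m :: complex mat)"
    show "(mat_adjoint (frame_mat n m v) * frame_mat n m v) $$ (i, j) = 1\<^sub>m m $$ (i, j)"
      using adjoint_frame_mat_mult_index[where i = i and j = j, OF v one_carrier_mat[of n]] ij a v[of j] assms
      by (simp add: orthonormal_def)
  qed auto
qed

text \<open>With more vectors than coordinates the frame matrix would kill a nonzero vector,
  although its adjoint is a left inverse.\<close>

lemma orthonormal_le:
  assumes o: "orthonormal n m v"
  shows "m \<le> n"
proof (rule ccontr)
  let ?V = "frame_mat n m v"
  assume "\<not> m \<le> n"
  then have "n < m" by simp
  then obtain c where c: "c \<in> carrier_vec m" "c \<noteq> 0\<^sub>v m"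
      "\<And>i. i < n \<Longrightarrow> (\<Sum>j<m. v j $ i * c $ j) = 0"
    using wide_system_solution[of n m "\<lambda>i j. v j $ i"] by metis
  have "?V *\<^sub>v c = 0\<^sub>v n"
  proof (rule eq_vecI)
    fix i assume "i < dim_vec (0\<^sub>v n :: complex vec)"
    then show "(?V *\<^sub>v c) $ i = 0\<^sub>v n $ i"
      using c(1,3) by (simp add: frame_mat_def scalar_prod_def lessThan_atLeast0)
  qed simp
  moreover have "mat_adjoint ?V *\<^sub>v (?V *\<^sub>v c) = c"
    using assoc_mult_mat_vec[OF mat_adjoint_carrier[OF frame_mat_carrier[of n m v]] frame_mat_carrier[of n m v] c(1)]
      orthonormal_frame_mat[OF o] c(1) by simp
  ultimately have "c = 0\<^sub>v m"
    using mat_mult_zero_vec[OF mat_adjoint_carrier[OF frame_mat_carrier[of n m v]]] by simp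
  then show False using c(2) by simp
qed

text \<open>Being orthogonal to m vectors is a system of m linear equations in n unknowns, so no
  Gram-Schmidt process is needed.\<close>

lemma orthonormal_extend_step:
  assumes o: "orthonormal n m v" and "m < n"
  shows "\<exists>y. orthonormal n (Suc m) (v(m := y))"
proof -
  obtain x where x: "x \<in> carrier_vec n" "x \<noteq> 0\<^sub>v n" "\<And>i. i < m \<Longrightarrow> (\<Sum>j<n. cnj (v i $ j) * x $ j) = 0"
    using wide_system_solution[OF \<open>m < n\<close>, of "\<lambda>i j. cnj (v i $ j)"] by metis
  have v: "\<And>j. j < m \<Longrightarrow> v j \<in> carrier_vec n" using o by (simp add: orthonormal_def)
  let ?y = "complex_of_real (1 / vec_norm2 x) \<cdot>\<^sub>v x"
  have y: "?y \<in> carrier_vec n" using x by simp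
  have yv: "?y \<bullet>c v i = 0" if "i < m" for i
  proof -
    have "x \<bullet>c v i = 0" using x(3)[OF that] v[OF that] by (simp add: cscalar_prod_eq_sum mult.commute)
    then show ?thesis unfolding cscalar_prod_smult_left[OF x(1) v[OF that]] by simp
  qed
  have vy: "v i \<bullet>c ?y = 0" if "i < m" for i
    using cscalar_prod_swap[OF y v[OF that]] yv[OF that] by simp
  have "?y \<bullet>c ?y = 1" using normalize_vec[OF x(1,2)] cscalar_prod_self[of ?y] by simp
  then have "orthonormal n (Suc m) (v(m := ?y))"
    using o y yv vy unfolding orthonormal_def less_Suc_eq by auto
  then show ?thesis by blast
qed

lemma orthonormal_extend:
  assumes "orthonormal n m v"
  obtains w where "orthonormal n n w" "\<And>i. i < m \<Longrightarrow> w i = v i"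
proof -
  have "m \<le> n \<Longrightarrow> orthonormal n m v \<Longrightarrow> \<exists>w. orthonormal n n w \<and> (\<forall>i<m. w i = v i)"
  proof (induction "n - m" arbitrary: m v)
    case (Suc d)
    have "m < n" using Suc.hyps(2) by linarith
    then obtain y where y: "orthonormal n (Suc m) (v(m := y))"
      using orthonormal_extend_step[OF Suc.prems(2)] by blast
    moreover have "d = n - Suc m" "Suc m \<le> n" using Suc.hyps(2) by auto
    ultimately obtain w where w: "orthonormal n n w" "\<forall>i<Suc m. w i = (v(m := y)) i"
      using Suc.hyps(1)[of "Suc m" "v(m := y)"] by blast
    then show ?case by (metis fun_upd_apply less_SucI nat_neq_iff)
  qed auto
  then show thesis using that orthonormal_le[OF assms] assms by metis
qed

lemma unitary_frame_mat:
  assumes "orthonormal n n v"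
  shows "unitary_mat (frame_mat n n v)"
    "frame_mat n n v * mat_adjoint (frame_mat n n v) = 1\<^sub>m n"
proof -
  have a: "mat_adjoint (frame_mat n n v) \<in> carrier_mat n n" by (rule mat_adjoint_carrier) simp
  show "frame_mat n n v * mat_adjoint (frame_mat n n v) = 1\<^sub>m n"
    using mat_mult_left_right_inverse[OF a frame_mat_carrier orthonormal_frame_mat[OF assms]] .
  then show "unitary_mat (frame_mat n n v)"
    using orthonormal_frame_mat[OF assms] by (simp add: unitary_mat_def inverts_mat_def)
qed

text \<open>The last two hypotheses say that the orthogonal complement of the family and its span
  are invariant. In an orthonormal basis prolonging the family they make the upper right and the
  lower left block vanish, while \<open>AC\<close> identifies the upper left block with C; whatever
  remains is B.\<close>

lemma unitarily_similar_diag_block: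
  fixes A :: "complex mat"
  assumes A: "A \<in> carrier_mat n n" and C: "C \<in> carrier_mat m m" and o: "orthonormal n m v"
    and AC: "\<And>i j. i < m \<Longrightarrow> j < m \<Longrightarrow> (A *\<^sub>v v j) \<bullet>c v i = C $$ (i, j)"
    and compl: "\<And>y i. y \<in> carrier_vec n \<Longrightarrow> \<forall>i<m. v i \<bullet>c y = 0 \<Longrightarrow> i < m \<Longrightarrow> v i \<bullet>c (A *\<^sub>v y) = 0"
    and inv: "\<And>y j. y \<in> carrier_vec n \<Longrightarrow> \<forall>i<m. v i \<bullet>c y = 0 \<Longrightarrow> j < m \<Longrightarrow> (A *\<^sub>v v j) \<bullet>c y = 0"
  obtains B where "m \<le> n" "B \<in> carrier_mat (n - m) (n - m)" "unitarily_similar A (diag_block_mat [C, B])"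
proof -
  have mn: "m \<le> n" by (rule orthonormal_le[OF o])
  obtain w where w: "orthonormal n n w" "\<And>i. i < m \<Longrightarrow> w i = v i"
    using orthonormal_extend[OF o] by metis
  have wc: "\<And>i. i < n \<Longrightarrow> w i \<in> carrier_vec n" using w(1) by (simp add: orthonormal_def)
  have perp: "\<forall>i<m. v i \<bullet>c w j = 0" if "m \<le> j" "j < n" for j
  proof (intro allI impI)
    fix i assume "i < m"
    then have "i < n" "i \<noteq> j" "w i = v i" using that w(2) by auto
    then show "v i \<bullet>c w j = 0" using w(1) that by (auto simp: orthonormal_def)
  qed
  let ?U = "frame_mat n n w"
  have aU: "mat_adjoint ?U \<in> carrier_mat n n" by (rule mat_adjoint_carrier) simp
  define D where "D = mat_adjoint ?U * A * ?U"
  have Dc: "D \<in> carrier_mat n n" unfolding D_def by (rule mult_carrier_mat[OF mult_carrier_mat[OF aU A] frame_mat_carrier])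
  have Dij: "D $$ (i, j) = (A *\<^sub>v w j) \<bullet>c w i" if "i < n" "j < n" for i j
    unfolding D_def by (rule adjoint_frame_mat_mult_index[OF wc A that])
  define B where "B = mat (n - m) (n - m) (\<lambda>(i, j). D $$ (i + m, j + m))"
  have "D = diag_block_mat [C, B]"
  proof (rule eq_matI)
    fix i j
    assume "i < dim_row (diag_block_mat [C, B])" "j < dim_col (diag_block_mat [C, B])"
    then have ij: "i < n" "j < n" using C mn by (auto simp: B_def)
    have 1: "D $$ (i, j) = C $$ (i, j)" if "i < m" "j < m"
      using AC[OF that] w(2) that Dij[OF ij] by simp
    have 2: "D $$ (i, j) = 0" if "i < m" "m \<le> j"
    proof -
      have "v i \<bullet>c (A *\<^sub>v w j) = 0" using compl[OF wc[OF ij(2)] perp[OF that(2) ij(2)] that(1)] .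
      then show ?thesis
        using cscalar_prod_swap[of "v i" n "A *\<^sub>v w j"] Dij[OF ij] w(2)[OF that(1)] wc[OF ij(1)] wc[OF ij(2)] A by simp
    qed
    have 3: "D $$ (i, j) = 0" if "m \<le> i" "j < m"
      using inv[OF wc[OF ij(1)] perp[OF that(1) ij(1)] that(2)] Dij[OF ij] w(2)[OF that(2)] by simp
    show "D $$ (i, j) = diag_block_mat [C, B] $$ (i, j)"
      using 1 2 3 ij C mn by (auto simp: B_def Let_def not_less)
  qed (use C Dc mn in \<open>auto simp: B_def\<close>)
  moreover have "similar_mat_wit A D ?U (mat_adjoint ?U)"
  proof (rule similar_mat_witI)
    show "?U * mat_adjoint ?U = 1\<^sub>m n" by (rule unitary_frame_mat(2)[OF w(1)])
    show "mat_adjoint ?U * ?U = 1\<^sub>m n" by (rule orthonormal_frame_mat[OF w(1)])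
    have UC: "?U \<in> carrier_mat n n" by simp
    have "?U * D = ?U * mat_adjoint ?U * A * ?U"
      unfolding D_def by (simp only: assoc_mult_mat[OF UC mult_carrier_mat[OF aU A] UC] assoc_mult_mat[OF UC aU A])
    then show "A = ?U * D * mat_adjoint ?U"
      using A assoc_mult_mat[OF A UC aU] by (simp add: unitary_frame_mat(2)[OF w(1)])
  qed (use A Dc aU in auto)
  ultimately have "unitarily_similar A (diag_block_mat [C, B])"
    using unitary_frame_mat(1)[OF w(1)] by (auto simp: unitarily_similar_def)
  then show thesis using that[of B] mn by (simp add: B_def)
qed

subsection \<open>Unimodular eigenvalues of contractions\<close>

text \<open>An eigenvalue of largest modulus is wanted on the unit circle. It cannot lie outside, as
  T is a contraction; lying inside is excluded by the growth of the powers of a slightly enlarged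
  T.\<close>

lemma contraction_unimodular_eigenvector:
  assumes T: "contraction n T" and n: "n > 0" and norm: "\<And>k. op_norm (T ^\<^sub>m k) = 1"
  obtains c x where "cmod c = 1" "x \<in> carrier_vec n" "vec_norm2 x = 1" "T *\<^sub>v x = c \<cdot>\<^sub>v x"
proof -
  note TC = contraction_carrier[OF T]
  have eig: "\<exists>x. x \<in> carrier_vec n \<and> vec_norm2 x = 1 \<and> A *\<^sub>v x = c \<cdot>\<^sub>v x"
    if A: "A \<in> carrier_mat n n" and c: "c \<in> spectrum A" for c and A :: "complex mat"
  proof -
    obtain v where v: "v \<in> carrier_vec n" "v \<noteq> 0\<^sub>v n" "A *\<^sub>v v = c \<cdot>\<^sub>v v"
      using c carrier_matD(1)[OF A] by (auto simp: spectrum_def eigenvalue_def eigenvector_def)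
    let ?u = "complex_of_real (1 / vec_norm2 v) \<cdot>\<^sub>v v"
    have "A *\<^sub>v ?u = c \<cdot>\<^sub>v ?u"
      unfolding mult_mat_vec[OF A v(1)] v(3) by (simp add: smult_smult_assoc mult.commute)
    then show ?thesis using normalize_vec[OF v(1,2)] v(1) by (intro exI[of _ ?u]) simp
  qed
  let ?r = "spectral_radius T"
  obtain c where c: "c \<in> spectrum T" "cmod c = ?r" using spectral_radius_mem_max(1)[OF TC n] by auto
  obtain x where x: "x \<in> carrier_vec n" "vec_norm2 x = 1" "T *\<^sub>v x = c \<cdot>\<^sub>v x" using eig[OF TC c(1)] by blast
  have "cmod c \<le> 1" using contractionD[OF T x(1)] x by (simp add: vec_norm2_smult)
  moreover have "\<not> ?r < 1"
  proof
    assume r: "?r < 1"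
    have r0: "?r \<ge> 0" using c(2) by (metis norm_ge_zero)
    \<comment> \<open>Any d > 1 with d r < 1 would do, where r is the spectral radius; this one
      satisfies both also for r = 0.\<close>
    define d where "d = 2 / (1 + ?r)"
    have d: "d > 1" "d * ?r < 1" using r r0 by (auto simp: d_def field_simps)
    define S where "S = complex_of_real d \<cdot>\<^sub>m T"
    have SC: "S \<in> carrier_mat n n" using TC by (simp add: S_def)
    have Sv: "S *\<^sub>v y = complex_of_real d \<cdot>\<^sub>v (T *\<^sub>v y)" if "y \<in> carrier_vec n" for y
      using TC that by (intro eq_vecI) (auto simp: S_def)
    have "spectral_radius S < 1"
    proof -
      obtain l where l: "l \<in> spectrum S" "cmod l = spectral_radius S"
        using spectral_radius_mem_max(1)[OF SC n] by auto
      obtain y where y: "y \<in> carrier_vec n" "vec_norm2 y = 1" "S *\<^sub>v y = l \<cdot>\<^sub>v y" using eig[OF SC l(1)] by blast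
      have "T *\<^sub>v y = (1 / complex_of_real d) \<cdot>\<^sub>v (S *\<^sub>v y)"
        using Sv[OF y(1)] d by (simp add: smult_smult_assoc)
      then have "T *\<^sub>v y = (l / d) \<cdot>\<^sub>v y" using y(3) by (simp add: smult_smult_assoc)
      moreover have "y \<noteq> 0\<^sub>v n" using y(2) by auto
      ultimately have "l / d \<in> spectrum T"
        using y TC by (auto simp: spectrum_def eigenvalue_def eigenvector_def)
      then have "cmod (l / d) \<le> ?r" using spectral_radius_mem_max(2)[OF TC n] by blast
      then show ?thesis using l(2) d by (simp add: norm_divide field_simps)
    qed
    then obtain b where b: "\<And>k. norm_bound (S ^\<^sub>m k) b"
      using spectral_radius_jnf_norm_bound_less_1_upper_triangular[OF SC] by blast
    have Spow: "S ^\<^sub>m k *\<^sub>v y = complex_of_real (d ^ k) \<cdot>\<^sub>v (T ^\<^sub>m k *\<^sub>v y)" if y: "y \<in> carrier_vec n" for k y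
    proof (induction k)
      case 0
      then show ?case using SC TC y by simp
    next
      case (Suc k)
      have Ty: "T ^\<^sub>m k *\<^sub>v y \<in> carrier_vec n" by (rule mult_mat_vec_carrier[OF pow_carrier_mat[OF TC] y])
      show ?case
        unfolding pow_Suc_mult_vec[OF SC y] pow_Suc_mult_vec[OF TC y] Suc.IH mult_mat_vec[OF SC Ty] Sv[OF Ty]
        by (simp add: smult_smult_assoc mult.commute)
    qed
    \<comment> \<open>Entries of the powers of S have modulus at most b and those of a unit vector
      at most 1, so each of the n entries of the image has modulus at most n b.\<close>
    let ?R = "real n * (real n * b)\<^sup>2"
    have le: "(d ^ k)\<^sup>2 \<le> ?R" for k
    proof -
      obtain y where y: "y \<in> carrier_vec n" "vec_norm2 y = 1" "vec_norm2 (T ^\<^sub>m k *\<^sub>v y) = 1"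
        using contraction_op_norm_attained[OF contraction_pow[OF T] norm] by blast
      let ?M = "S ^\<^sub>m k"
      have MC: "?M \<in> carrier_mat n n" using pow_carrier_mat[OF SC] .
      have "vec_norm2 (?M *\<^sub>v y) = d ^ k" using d(1) y(3) by (simp add: Spow[OF y(1)] vec_norm2_smult norm_power)
      then have "(d ^ k)\<^sup>2 = (\<Sum>i<n. (cmod ((?M *\<^sub>v y) $ i))\<^sup>2)"
        using vec_norm2_sq[of "?M *\<^sub>v y"] SC by simp
      also have "\<dots> \<le> (\<Sum>i<n. (real n * b)\<^sup>2)"
      proof (intro sum_mono power_mono)
        fix i assume i: "i \<in> {..<n}"
        have y1: "cmod (y $ j) \<le> 1" if "j < n" for j
        proof -
          have "(cmod (y $ j))\<^sup>2 \<le> (\<Sum>j<n. (cmod (y $ j))\<^sup>2)"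
            by (rule member_le_sum) (use that in auto)
          then show ?thesis using vec_norm2_sq[of y] y by (simp add: power2_le_iff_abs_le abs_square_le_1)
        qed
        have "(?M *\<^sub>v y) $ i = (\<Sum>j<n. ?M $$ (i, j) * y $ j)"
          using MC i y(1) SC by (simp add: scalar_prod_def lessThan_atLeast0)
        also have "cmod \<dots> \<le> (\<Sum>j<n. b)"
        proof (rule sum_norm_le)
          fix j assume j: "j \<in> {..<n}"
          have "cmod (?M $$ (i, j)) \<le> b" using b[of k] i j SC by (auto simp: norm_bound_def)
          then show "cmod (?M $$ (i, j) * y $ j) \<le> b"
            using y1[of j] j mult_mono[of "cmod (?M $$ (i, j))" b "cmod (y $ j)" 1] norm_ge_zero[of "?M $$ (i, j)"]
            by (simp add: norm_mult)
        qed
        finally show "cmod ((?M *\<^sub>v y) $ i) \<le> real n * b" by simp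
      qed simp
      finally show ?thesis by simp
    qed
    obtain k where k: "?R + 1 < d ^ k" using real_arch_pow[OF d(1)] by blast
    have "d ^ k \<le> (d ^ k)\<^sup>2" using d(1) by (intro self_le_power) (auto simp: one_le_power)
    then show False using k le[of k] by simp
  qed
  ultimately show thesis using that[of c x] c x by simp
qed

text \<open>For y orthogonal to x, isometry at x turns <T x, T y> = <x, y> into c <x, T y> = 0, and
  c is nonzero. So x spans a reducing line, on which T is the 1-by-1 unitary with entry c.\<close>

lemma contraction_unitary_part:
  assumes T: "contraction n T" and c: "cmod c = 1"
    and x: "x \<in> carrier_vec n" "vec_norm2 x = 1" "T *\<^sub>v x = c \<cdot>\<^sub>v x"
  shows "has_unitary_part T"
proof -
  note TC = contraction_carrier[OF T]
  have c0: "c \<noteq> 0" using c by auto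
  let ?C = "mat 1 1 (\<lambda>_. c)"
  have cc: "c * cnj c = 1" using c complex_norm_square[of c] by simp
  have iso: "vec_norm2 (T *\<^sub>v x) = vec_norm2 x" using x c by (simp add: vec_norm2_smult)
  obtain B where B: "B \<in> carrier_mat (n - 1) (n - 1)" "unitarily_similar T (diag_block_mat [?C, B])"
  proof (rule unitarily_similar_diag_block[OF TC, of ?C 1 "\<lambda>_. x"])
    show "orthonormal n 1 (\<lambda>_. x)" using x cscalar_prod_self[of x] by (simp add: orthonormal_def)
    show "(T *\<^sub>v x) \<bullet>c x = ?C $$ (i, j)" if "i < 1" "j < 1" for i j
      using that x cscalar_prod_self[of x] cscalar_prod_smult_left[OF x(1) x(1), of c] by simp
    show "(T *\<^sub>v x) \<bullet>c y = 0" if "y \<in> carrier_vec n" "\<forall>i<1::nat. x \<bullet>c y = 0" for y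
      using that x cscalar_prod_smult_left[OF x(1) that(1), of c] by simp
    show "x \<bullet>c (T *\<^sub>v y) = 0" if y: "y \<in> carrier_vec n" "\<forall>i<1::nat. x \<bullet>c y = 0" for y
    proof -
      have "c * (x \<bullet>c (T *\<^sub>v y)) = x \<bullet>c y"
        using contraction_isometric_vec[OF T x(1) y(1) iso] x TC y
          cscalar_prod_smult_left[OF x(1), of "T *\<^sub>v y" c] by simp
      then show ?thesis using y c0 by simp
    qed
  qed auto
  have "mat_adjoint ?C = mat 1 1 (\<lambda>_. cnj c)"
    by (intro eq_matI) (auto simp: mat_adjoint_index)
  then have "unitary_mat ?C"
    using cc by (auto simp: unitary_mat_def inverts_mat_def scalar_prod_def mult.commute intro!: eq_matI)
  then show ?thesis using B unfolding has_unitary_part_def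
    by (intro exI[of _ ?C] exI[of _ B]) auto
qed

subsection \<open>Numerical radius of nilpotent contractions\<close>

lemma numerical_radius_upper:
  assumes A: "A \<in> carrier_mat n n" and x: "x \<in> carrier_vec n" "vec_norm2 x = 1"
  shows "cmod ((A *\<^sub>v x) \<bullet>c x) \<le> numerical_radius A"
proof -
  let ?S = "{x \<in> carrier_vec (dim_col A). vec_norm2 x = 1}"
  obtain K where K: "\<And>x. x \<in> carrier_vec n \<Longrightarrow> vec_norm2 (A *\<^sub>v x) \<le> K * vec_norm2 x"
    using mult_mat_vec_norm_bound[OF A] by metis
  have "bdd_above ((\<lambda>x. cmod ((A *\<^sub>v x) \<bullet>c x)) ` ?S)"
  proof (rule bdd_aboveI2)
    fix y assume "y \<in> ?S"
    then have y: "y \<in> carrier_vec n" "vec_norm2 y = 1" using A by auto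
    show "cmod ((A *\<^sub>v y) \<bullet>c y) \<le> K"
      using cscalar_prod_Cauchy_Schwarz[OF mult_mat_vec_carrier[OF A y(1)] y(1)] K[OF y(1)] y(2) by simp
  qed
  then show ?thesis unfolding numerical_radius_def by (rule cSUP_upper[rotated]) (use A x in auto)
qed

text \<open>The unit vector x guarantees that the supremum is not taken over the empty set.\<close>

lemma numerical_radius_least:
  assumes A: "A \<in> carrier_mat n n" and ne: "x \<in> carrier_vec n" "vec_norm2 x = 1"
    and "\<And>y. y \<in> carrier_vec n \<Longrightarrow> vec_norm2 y = 1 \<Longrightarrow> cmod ((A *\<^sub>v y) \<bullet>c y) \<le> K"
  shows "numerical_radius A \<le> K"
  unfolding numerical_radius_def by (rule cSUP_least) (use assms in auto)

lemma numerical_radius_unimodular_eigenvector: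
  assumes T: "contraction n T" and c: "cmod c = 1"
    and x: "x \<in> carrier_vec n" "vec_norm2 x = 1" "T *\<^sub>v x = c \<cdot>\<^sub>v x"
  shows "numerical_radius T = 1"
proof (rule antisym)
  note TC = contraction_carrier[OF T]
  show "numerical_radius T \<le> 1"
  proof (rule numerical_radius_least[OF TC x(1,2)])
    fix y :: "complex vec" assume y: "y \<in> carrier_vec n" "vec_norm2 y = 1"
    show "cmod ((T *\<^sub>v y) \<bullet>c y) \<le> 1"
      using cscalar_prod_Cauchy_Schwarz[OF mult_mat_vec_carrier[OF TC y(1)] y(1)] contractionD[OF T y(1)] y(2) by simp
  qed
  show "1 \<le> numerical_radius T"
    using numerical_radius_upper[OF TC x(1,2)] x c cscalar_prod_smult_left[OF x(1,1), of c] cscalar_prod_self[of x]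
    by simp
qed

lemma vec_norm2_pow_antimono:
  assumes T: "contraction n T" and x: "x \<in> carrier_vec n" and "i \<le> j"
  shows "vec_norm2 (T ^\<^sub>m j *\<^sub>v x) \<le> vec_norm2 (T ^\<^sub>m i *\<^sub>v x)"
proof -
  note TC = contraction_carrier[OF T]
  have "T ^\<^sub>m j *\<^sub>v x = T ^\<^sub>m (j - i) *\<^sub>v (T ^\<^sub>m i *\<^sub>v x)"
    using pow_add_mult_vec[OF TC x, of "j - i" i] \<open>i \<le> j\<close> by simp
  then show ?thesis
    using contractionD[OF contraction_pow[OF T] mult_mat_vec_carrier[OF pow_carrier_mat[OF TC] x]] by simp
qed

text \<open>Made a locale because it is instantiated twice with the same k, for the matrix and for
  its Kronecker square; the numerical radius will turn out to depend on k alone.\<close>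

locale norm_attaining_nilpotent =
  fixes n k :: nat and T :: "complex mat" and x :: "complex vec"
  assumes T: "contraction n T" and nil: "T ^\<^sub>m Suc k = 0\<^sub>m n n"
    and x: "x \<in> carrier_vec n" "vec_norm2 x = 1" and Tk: "vec_norm2 (T ^\<^sub>m k *\<^sub>v x) = 1"
begin

abbreviation orbit :: "nat \<Rightarrow> complex vec" where "orbit i \<equiv> T ^\<^sub>m i *\<^sub>v x"

lemmas TC = contraction_carrier[OF T]
lemmas powC = pow_carrier_mat[OF TC]

lemma pow_vec [simp]: "y \<in> carrier_vec n \<Longrightarrow> T ^\<^sub>m i *\<^sub>v y \<in> carrier_vec n"
  by (rule mult_mat_vec_carrier[OF powC])

lemma T_vec [simp]: "y \<in> carrier_vec n \<Longrightarrow> T *\<^sub>v y \<in> carrier_vec n"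
  by (rule mult_mat_vec_carrier[OF TC])

lemma pow_vanishes:
  assumes "Suc k \<le> i" "y \<in> carrier_vec n"
  shows "T ^\<^sub>m i *\<^sub>v y = 0\<^sub>v n"
  using pow_add_mult_vec[OF TC assms(2), of "i - Suc k" "Suc k"] assms nil mat_mult_zero_vec[OF powC] by simp

text \<open>The norms decrease along the orbit, and both ends are 1.\<close>

lemma orbit_norm: "i \<le> k \<Longrightarrow> vec_norm2 (orbit i) = 1"
  using vec_norm2_pow_antimono[OF T x(1), of i k] vec_norm2_pow_antimono[OF T x(1), of 0 i] Tk x TC by simp

lemma orbit_isometric:
  assumes "i + l \<le> k" "y \<in> carrier_vec n"
  shows "orbit (l + i) \<bullet>c (T ^\<^sub>m l *\<^sub>v y) = orbit i \<bullet>c y"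
  using contraction_isometric_vec[OF contraction_pow[OF T, of l] pow_vec[OF x(1), of i] assms(2)]
    orbit_norm[of "l + i"] orbit_norm[of i] pow_add_mult_vec[OF TC x(1), of l i] assms(1) by (simp add: add.commute)

text \<open>Shift both vectors by l = k + 1 - j steps. The later one reaches exponent k + 1 and
  vanishes, while the earlier one reaches i + l <= k because i < j, so the shift is still isometric
  on it.\<close>

lemma orbit_orthogonal:
  assumes "i < j" "j \<le> k"
  shows "orbit i \<bullet>c orbit j = 0"
proof -
  let ?l = "Suc k - j"
  have "orbit i \<bullet>c orbit j = orbit (?l + i) \<bullet>c (T ^\<^sub>m ?l *\<^sub>v orbit j)"
    by (rule orbit_isometric[symmetric]) (use assms x in auto)
  also have "T ^\<^sub>m ?l *\<^sub>v orbit j = 0\<^sub>v n"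
    using pow_add_mult_vec[OF TC x(1), of ?l j] assms pow_vanishes[OF _ x(1), of "?l + j"] by simp
  finally show ?thesis using scalar_prod_right_zero[OF pow_vec[OF x(1), of "?l + i"]] by simp
qed

text \<open>The orbit is listed backwards so that T lowers the index, which places the ones on the
  superdiagonal.\<close>

definition chain :: "nat \<Rightarrow> complex vec" where "chain i = orbit (k - i)"

lemma chain_orthonormal: "orthonormal n (Suc k) chain"
  unfolding orthonormal_def
proof (intro conjI allI impI)
  fix i j assume ij: "i < Suc k" "j < Suc k"
  consider "i = j" | "k - i < k - j" | "k - j < k - i" using ij by linarith
  then show "chain i \<bullet>c chain j = (if i = j then 1 else 0)"
  proof cases
    case 1
    then show ?thesis using orbit_norm[of "k - i"] by (simp add: chain_def cscalar_prod_self)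
  next
    case 2
    then show ?thesis using orbit_orthogonal[OF 2] by (auto simp: chain_def)
  next
    case 3
    then show ?thesis
      using orbit_orthogonal[OF 3] cscalar_prod_swap[of "orbit (k - j)" n "orbit (k - i)"] x
      by (auto simp: chain_def)
  qed
qed (simp add: chain_def x)

lemma chain_step: "j < Suc k \<Longrightarrow> T *\<^sub>v chain j = (if j = 0 then 0\<^sub>v n else chain (j - 1))"
proof -
  assume j: "j < Suc k"
  have "T *\<^sub>v chain j = orbit (Suc (k - j))" by (simp only: chain_def pow_Suc_mult_vec[OF TC x(1)])
  then show ?thesis using j pow_vanishes[OF _ x(1), of "Suc k"] by (auto simp: chain_def Suc_diff_le)
qed

lemma chain_jordan_block:
  assumes "i < Suc k" "j < Suc k"
  shows "(T *\<^sub>v chain j) \<bullet>c chain i = jordan_block (Suc k) 0 $$ (i, j)"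
proof (cases j)
  case 0
  then show ?thesis using assms chain_step[of 0] x by (simp add: chain_def)
next
  case (Suc l)
  then show ?thesis using assms chain_step[of j] chain_orthonormal by (auto simp: orthonormal_def)
qed

text \<open>Invariance of the complement is the real content. For l > 0, <T^l x, T y> pulls back to
  <T^(l-1) x, y> = 0. For l = 0 there is nothing to pull back to, and one pushes forward by T^k
  instead, where T^(k+1) y = 0.\<close>

lemma jordan_block_summand:
  obtains B where "Suc k \<le> n" "B \<in> carrier_mat (n - Suc k) (n - Suc k)"
    "unitarily_similar T (diag_block_mat [jordan_block (Suc k) 0, B])"
proof (rule unitarily_similar_diag_block[OF TC _ chain_orthonormal chain_jordan_block])
  fix y i assume y: "y \<in> carrier_vec n" "\<forall>i<Suc k. chain i \<bullet>c y = 0" and i: "i < Suc k"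
  have perp: "orbit l \<bullet>c y = 0" if "l \<le> k" for l
    using y(2)[rule_format, of "k - l"] that by (simp add: chain_def)
  have "orbit l \<bullet>c (T *\<^sub>v y) = 0" if l: "l \<le> k" for l
  proof (cases l)
    case 0
    have "orbit 0 \<bullet>c (T *\<^sub>v y) = orbit (k + 0) \<bullet>c (T ^\<^sub>m k *\<^sub>v (T *\<^sub>v y))"
      by (rule orbit_isometric[symmetric]) (use y in auto)
    also have "T ^\<^sub>m k *\<^sub>v (T *\<^sub>v y) = T ^\<^sub>m (k + 1) *\<^sub>v y"
      using pow_add_mult_vec[OF TC y(1), of k 1] TC by simp
    also have "\<dots> = 0\<^sub>v n" by (rule pow_vanishes) (use y in auto)
    finally show ?thesis using 0 scalar_prod_right_zero[OF pow_vec[OF x(1), of k]] by simp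
  next
    case (Suc l')
    have "orbit (1 + l') \<bullet>c (T ^\<^sub>m 1 *\<^sub>v y) = orbit l' \<bullet>c y"
      by (rule orbit_isometric) (use Suc l y in auto)
    then show ?thesis using perp[of l'] Suc l TC by simp
  qed
  then show "chain i \<bullet>c (T *\<^sub>v y) = 0" using i by (simp add: chain_def)
next
  fix y j assume y: "y \<in> carrier_vec n" "\<forall>i<Suc k. chain i \<bullet>c y = 0" and j: "j < Suc k"
  show "(T *\<^sub>v chain j) \<bullet>c y = 0"
    using chain_step[OF j] y j by (cases j) auto
qed (use that in auto)

text \<open>With \<open>[u, v] = \<langle>u, v\<rangle> - \<langle>T u, T v\<rangle>\<close>, both \<open>\<langle>T y, y\<rangle> = \<Sum>\<^sub>j [T\<^sup>j\<^sup>+\<^sup>1 y, T\<^sup>j y]\<close> and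
  \<open>\<parallel>y\<parallel>\<^sup>2 = \<Sum>\<^sub>j [T\<^sup>j y, T\<^sup>j y]\<close> telescope; the Cauchy-Schwarz inequality then compares
  \<open>\<langle>T y, y\<rangle>\<close> with the Jordan block evaluated at \<open>a\<^sub>j = [T\<^sup>j y, T\<^sup>j y]\<^sup>1\<^sup>/\<^sup>2\<close>.\<close>
lemma numerical_radius_le_jordan_block:
  "numerical_radius T \<le> numerical_radius (jordan_block (Suc k) 0)"
proof (rule numerical_radius_least[OF TC x])
  fix y :: "complex vec" assume y: "y \<in> carrier_vec n" "vec_norm2 y = 1"
  let ?J = "jordan_block (Suc k) (0::complex)"
  define N where "N j = (vec_norm2 (T ^\<^sub>m j *\<^sub>v y))\<^sup>2" for j
  define a where "a j = sqrt (N j - N (Suc j))" for j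
  define w where "w = vec (Suc k) (\<lambda>j. complex_of_real (a j))"
  note step = pow_Suc_mult_vec[OF TC y(1)]
  have anti: "N (Suc j) \<le> N j" for j
    unfolding N_def using vec_norm2_pow_antimono[OF T y(1), of j "Suc j"] by (simp add: power_mono)
  have a0: "a j \<ge> 0" for j using anti by (simp add: a_def)
  have a_sq: "(a j)\<^sup>2 = N j - N (Suc j)" for j using anti by (simp add: a_def)
  have Nk: "N (Suc k) = 0" using pow_vanishes[of "Suc k" y] y by (simp add: N_def del: pow_mat.simps)
  have "(\<Sum>j<Suc k. (a j)\<^sup>2) = N 0 - N (Suc k)"
    unfolding a_sq by (rule sum_lessThan_telescope')
  also have "\<dots> = 1" using Nk y TC by (simp add: N_def)
  finally have "(vec_norm2 w)\<^sup>2 = 1" using a0 by (simp add: vec_norm2_sq w_def del: sum.lessThan_Suc)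
  then have "vec_norm2 w = 1"
    unfolding power2_eq_1_iff using vec_norm2_nonneg[of w] by linarith
  then have w: "w \<in> carrier_vec (Suc k)" "vec_norm2 w = 1" by (simp_all add: w_def)
  define g where "g j = (T ^\<^sub>m Suc j *\<^sub>v y) \<bullet>c (T ^\<^sub>m j *\<^sub>v y)" for j
  have form: "g j - g (Suc j) = defect_form T (T ^\<^sub>m Suc j *\<^sub>v y) (T ^\<^sub>m j *\<^sub>v y)" for j
    unfolding g_def defect_form_def by (simp only: step)
  \<comment> \<open>The numbers \<open>g j\<close> vanish one index earlier than the norms
    \<open>N j\<close>. This leaves exactly k differences, one for each entry 1 of the Jordan block
    of size k + 1.\<close>
  have g0: "g k = 0" using pow_vanishes[of "Suc k" y] y pow_vec[of y k] by (simp add: g_def del: pow_mat.simps)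
  have bound: "cmod (g j - g (Suc j)) \<le> a (Suc j) * a j" for j
  proof (rule power2_le_imp_le)
    show "(cmod (g j - g (Suc j)))\<^sup>2 \<le> (a (Suc j) * a j)\<^sup>2"
      unfolding form power_mult_distrib a_sq N_def
      using defect_form_Cauchy_Schwarz[OF T pow_vec[OF y(1), of "Suc j"] pow_vec[OF y(1), of j]]
      by (simp only: step)
  qed (simp add: a0)
  have "(T *\<^sub>v y) \<bullet>c y = g 0 - g k" using g0 TC y by (simp add: g_def)
  also have "\<dots> = (\<Sum>j<k. g j - g (Suc j))" by (rule sum_lessThan_telescope'[symmetric])
  also have "cmod \<dots> \<le> (\<Sum>j<k. a (Suc j) * a j)" by (rule sum_norm_le) (rule bound)
  also have "\<dots> = cmod ((?J *\<^sub>v w) \<bullet>c w)"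
  proof -
    have Jw: "(?J *\<^sub>v w) $ i = (if i < k then complex_of_real (a (Suc i)) else 0)" if "i < Suc k" for i
    proof -
      have "(?J *\<^sub>v w) $ i = (\<Sum>j<Suc k. (if i = j then 0 else if Suc i = j then 1 else 0) * complex_of_real (a j))"
        using that by (simp add: w_def scalar_prod_def lessThan_atLeast0[symmetric] del: sum.lessThan_Suc)
      also have "\<dots> = (\<Sum>j<Suc k. if j = Suc i then complex_of_real (a (Suc i)) else 0)"
        by (intro sum.cong) auto
      finally show ?thesis using that by (simp add: sum.delta del: sum.lessThan_Suc)
    qed
    have "(?J *\<^sub>v w) \<bullet>c w = (\<Sum>i<Suc k. (?J *\<^sub>v w) $ i * complex_of_real (a i))"
      by (simp add: cscalar_prod_eq_sum w_def del: sum.lessThan_Suc)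
    also have "\<dots> = (\<Sum>i<Suc k. (if i < k then complex_of_real (a (Suc i)) else 0) * complex_of_real (a i))"
      by (intro sum.cong refl) (use Jw in auto)
    also have "\<dots> = complex_of_real (\<Sum>j<k. a (Suc j) * a j)"
      by simp
    finally show ?thesis using a0 by (simp add: sum_nonneg del: of_real_sum)
  qed
  also have "\<dots> \<le> numerical_radius ?J" by (rule numerical_radius_upper[OF _ w]) simp
  finally show "cmod ((T *\<^sub>v y) \<bullet>c y) \<le> numerical_radius ?J" .
qed

text \<open>For the lower bound the Jordan block is the compression of T by the isometry whose
  columns are the chain. Each of its values at a unit vector is then a value of T at the image, so
  the complementary summand never enters.\<close>

lemma numerical_radius_eq_jordan_block:
  "numerical_radius T = numerical_radius (jordan_block (Suc k) 0)"
proof (rule antisym[OF numerical_radius_le_jordan_block])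
  let ?J = "jordan_block (Suc k) (0::complex)" and ?V = "frame_mat n (Suc k) chain"
  have VC: "?V \<in> carrier_mat n (Suc k)" by simp
  have aV: "mat_adjoint ?V \<in> carrier_mat (Suc k) n" by (rule mat_adjoint_carrier) simp
  have ch: "\<And>j. j < Suc k \<Longrightarrow> chain j \<in> carrier_vec n" by (simp add: chain_def x)
  have J: "mat_adjoint ?V * T * ?V = ?J"
  proof (rule eq_matI)
    fix i j assume "i < dim_row ?J" "j < dim_col ?J"
    then have ij: "i < Suc k" "j < Suc k" by auto
    show "(mat_adjoint ?V * T * ?V) $$ (i, j) = ?J $$ (i, j)"
      using adjoint_frame_mat_mult_index[where i = i and j = j and v = chain, OF ch TC ij] chain_jordan_block[OF ij]
      by (simp only:)
  qed auto
  show "numerical_radius ?J \<le> numerical_radius T"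
  proof (rule numerical_radius_least)
    show "unit_vec (Suc k) 0 \<in> carrier_vec (Suc k)" by simp
    show "vec_norm2 (unit_vec (Suc k) 0) = 1" by (simp add: vec_norm2_def)
    fix c :: "complex vec" assume c: "c \<in> carrier_vec (Suc k)" "vec_norm2 c = 1"
    have Vc: "?V *\<^sub>v c \<in> carrier_vec n" by (rule mult_mat_vec_carrier[OF VC c(1)])
    have aVV: "mat_adjoint ?V *\<^sub>v (?V *\<^sub>v c) = c"
      using assoc_mult_mat_vec[OF aV VC c(1)] orthonormal_frame_mat[OF chain_orthonormal] c(1) by simp
    have "(?V *\<^sub>v c) \<bullet>c (?V *\<^sub>v c) = c \<bullet>c c"
      using mat_adjoint_cscalar_prod[OF VC Vc c(1)] aVV by simp
    then have norm: "vec_norm2 (?V *\<^sub>v c) = 1" using c(2) by (simp add: vec_norm2_def)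
    have "?J *\<^sub>v c = mat_adjoint ?V *\<^sub>v (T *\<^sub>v (?V *\<^sub>v c))"
      unfolding J[symmetric]
      using assoc_mult_mat_vec[OF mult_carrier_mat[OF aV TC] VC c(1)] assoc_mult_mat_vec[OF aV TC Vc] by simp
    then have "(?J *\<^sub>v c) \<bullet>c c = (T *\<^sub>v (?V *\<^sub>v c)) \<bullet>c (?V *\<^sub>v c)"
      using mat_adjoint_cscalar_prod[OF VC T_vec[OF Vc] c(1)] by simp
    then show "cmod ((?J *\<^sub>v c) \<bullet>c c) \<le> numerical_radius T"
      using numerical_radius_upper[OF TC Vc norm] by simp
  qed simp
qed

end

subsection \<open>Kronecker products\<close>

lemma kronecker_carrier [simp]:
  "A \<in> carrier_mat n n \<Longrightarrow> B \<in> carrier_mat n n \<Longrightarrow> kronecker A B \<in> carrier_mat (n * n) (n * n)"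
  by (auto simp: kronecker_def)

lemma pair_index_less: "i < n \<Longrightarrow> j < n \<Longrightarrow> i * n + j < n * n" for i j n :: nat
proof -
  assume "i < n" "j < n"
  then have "i * n + j < Suc i * n" by simp
  also have "\<dots> \<le> n * n" using \<open>i < n\<close> by (intro mult_right_mono) auto
  finally show ?thesis .
qed

lemma kronecker_index:
  assumes "A \<in> carrier_mat n n" "B \<in> carrier_mat n n" "i < n" "j < n" "i' < n" "j' < n"
  shows "kronecker A B $$ (i * n + j, i' * n + j') = A $$ (i, i') * B $$ (j, j')"
  using assms pair_index_less[of i n j] pair_index_less[of i' n j'] by (simp add: kronecker_def)

lemma sum_pair_index: "sum f {..<n * n} = (\<Sum>i<n. \<Sum>j<n. f (i * n + j))" for n :: nat
proof -
  have "(\<Sum>j\<in>{i * n..<i * n + n}. f j) = (\<Sum>j<n. f (i * n + j))" for i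
    using sum.shift_bounds_nat_ivl[of f 0 "i * n" n] by (simp add: lessThan_atLeast0 add.commute)
  then show ?thesis using sum.nat_group[of f n n] by simp
qed

lemma pair_index_cases:
  fixes p n :: nat
  assumes "p < n * n"
  obtains i j where "p = i * n + j" "i < n" "j < n"
proof (rule that[of "p div n" "p mod n"])
  show "p div n < n" using assms by (rule less_mult_imp_div_less)
  show "p mod n < n" using assms by (cases n) auto
qed simp

lemma eq_vec_pairI:
  assumes "v \<in> carrier_vec (n * n)" "w \<in> carrier_vec (n * n)"
    and "\<And>i j. i < n \<Longrightarrow> j < n \<Longrightarrow> v $ (i * n + j) = w $ (i * n + j)"
  shows "v = w"
proof (rule eq_vecI)
  fix p assume "p < dim_vec w"
  then show "v $ p = w $ p" using assms by (auto elim!: pair_index_cases)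
qed (use assms in auto)

lemma kronecker_mult_vec_index:
  assumes A: "A \<in> carrier_mat n n" "B \<in> carrier_mat n n" and z: "z \<in> carrier_vec (n * n)" and i: "i < n" "j < n"
  shows "(kronecker A B *\<^sub>v z) $ (i * n + j) = (\<Sum>i'<n. \<Sum>j'<n. A $$ (i, i') * B $$ (j, j') * z $ (i' * n + j'))"
proof -
  have KC: "kronecker A B \<in> carrier_mat (n * n) (n * n)" using A by simp
  have "(kronecker A B *\<^sub>v z) $ (i * n + j) = (\<Sum>p<n * n. kronecker A B $$ (i * n + j, p) * z $ p)"
    using KC z pair_index_less[OF i] by (simp add: scalar_prod_def lessThan_atLeast0)
  then show ?thesis using A i by (simp add: sum_pair_index kronecker_index)
qed

definition kronecker_vec :: "nat \<Rightarrow> complex vec \<Rightarrow> complex vec \<Rightarrow> complex vec" where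
  "kronecker_vec n x y = vec (n * n) (\<lambda>p. x $ (p div n) * y $ (p mod n))"

lemma kronecker_vec_carrier [simp]: "kronecker_vec n x y \<in> carrier_vec (n * n)"
  by (simp add: kronecker_vec_def)

lemma kronecker_vec_index:
  "i < n \<Longrightarrow> j < n \<Longrightarrow> kronecker_vec n x y $ (i * n + j) = x $ i * y $ j"
  by (simp add: kronecker_vec_def pair_index_less)

lemma kronecker_mult_kronecker_vec:
  assumes A: "A \<in> carrier_mat n n" "B \<in> carrier_mat n n" and x: "x \<in> carrier_vec n" "y \<in> carrier_vec n"
  shows "kronecker A B *\<^sub>v kronecker_vec n x y = kronecker_vec n (A *\<^sub>v x) (B *\<^sub>v y)"
proof (rule eq_vec_pairI[of _ n])
  show "kronecker A B *\<^sub>v kronecker_vec n x y \<in> carrier_vec (n * n)"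
    by (rule mult_mat_vec_carrier[OF kronecker_carrier[OF A] kronecker_vec_carrier])
  fix i j assume i: "i < n" "j < n"
  have "(kronecker A B *\<^sub>v kronecker_vec n x y) $ (i * n + j)
     = (\<Sum>i'<n. \<Sum>j'<n. (A $$ (i, i') * x $ i') * (B $$ (j, j') * y $ j'))"
    unfolding kronecker_mult_vec_index[OF A kronecker_vec_carrier i]
    by (intro sum.cong refl) (simp add: kronecker_vec_index mult_ac)
  also have "\<dots> = (A *\<^sub>v x) $ i * (B *\<^sub>v y) $ j"
    using A x i by (simp add: sum_product[symmetric] scalar_prod_def lessThan_atLeast0)
  finally show "(kronecker A B *\<^sub>v kronecker_vec n x y) $ (i * n + j) = kronecker_vec n (A *\<^sub>v x) (B *\<^sub>v y) $ (i * n + j)"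
    using i by (simp add: kronecker_vec_index)
qed simp

lemma vec_norm2_sq_pair:
  assumes "z \<in> carrier_vec (n * n)"
  shows "(vec_norm2 z)\<^sup>2 = (\<Sum>i<n. \<Sum>j<n. (cmod (z $ (i * n + j)))\<^sup>2)"
  using assms by (simp add: vec_norm2_sq sum_pair_index)

lemma vec_norm2_kronecker_vec:
  assumes "x \<in> carrier_vec n" "y \<in> carrier_vec n"
  shows "vec_norm2 (kronecker_vec n x y) = vec_norm2 x * vec_norm2 y"
proof -
  have "(vec_norm2 (kronecker_vec n x y))\<^sup>2 = (\<Sum>i<n. \<Sum>j<n. (cmod (x $ i))\<^sup>2 * (cmod (y $ j))\<^sup>2)"
    by (simp add: vec_norm2_sq_pair[of _ n] kronecker_vec_index norm_mult power_mult_distrib)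
  also have "\<dots> = (vec_norm2 x * vec_norm2 y)\<^sup>2"
    using assms by (simp add: vec_norm2_sq power_mult_distrib sum_product)
  finally show ?thesis by (simp add: power2_eq_iff_nonneg)
qed

text \<open>Regard z as an n-by-n array. The Kronecker product first applies B to every row
  \<open>r i\<close>, then A to every column \<open>u j\<close> of the result; neither pass
  increases the sum of the squared moduli.\<close>

lemma kronecker_contraction:
  assumes A: "contraction n A" and B: "contraction n B"
  shows "contraction (n * n) (kronecker A B)"
  unfolding contraction_def
proof (intro conjI ballI)
  note AC = contraction_carrier[OF A] and BC = contraction_carrier[OF B]
  show KC: "kronecker A B \<in> carrier_mat (n * n) (n * n)" using AC BC by simp
  fix z :: "complex vec" assume z: "z \<in> carrier_vec (n * n)"
  have sq: "(\<Sum>i<n. (cmod ((T *\<^sub>v x) $ i))\<^sup>2) \<le> (\<Sum>i<n. (cmod (x $ i))\<^sup>2)"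
    if T: "contraction n T" and x: "x \<in> carrier_vec n" for T x
    using power_mono[OF contractionD[OF T x] vec_norm2_nonneg, of 2] contraction_carrier[OF T] x
    by (simp add: vec_norm2_sq)
  define r where "r i = vec n (\<lambda>j. z $ (i * n + j))" for i
  define u where "u j = vec n (\<lambda>i. (B *\<^sub>v r i) $ j)" for j
  have Kz: "(kronecker A B *\<^sub>v z) $ (i * n + j) = (A *\<^sub>v u j) $ i" if "i < n" "j < n" for i j
    using that AC BC
    by (simp add: kronecker_mult_vec_index[OF AC BC z that] u_def r_def scalar_prod_def lessThan_atLeast0
        sum_distrib_left mult.assoc)
  have "(vec_norm2 (kronecker A B *\<^sub>v z))\<^sup>2 = (\<Sum>i<n. \<Sum>j<n. (cmod ((A *\<^sub>v u j) $ i))\<^sup>2)"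
    using vec_norm2_sq_pair[OF mult_mat_vec_carrier[OF KC z]] Kz by simp
  also have "\<dots> = (\<Sum>j<n. \<Sum>i<n. (cmod ((A *\<^sub>v u j) $ i))\<^sup>2)" by (rule sum.swap)
  also have "\<dots> \<le> (\<Sum>j<n. \<Sum>i<n. (cmod (u j $ i))\<^sup>2)"
    by (intro sum_mono sq[OF A]) (simp add: u_def)
  also have "\<dots> = (\<Sum>i<n. \<Sum>j<n. (cmod (u j $ i))\<^sup>2)" by (rule sum.swap)
  also have "\<dots> = (\<Sum>i<n. \<Sum>j<n. (cmod ((B *\<^sub>v r i) $ j))\<^sup>2)"
    by (simp add: u_def)
  also have "\<dots> \<le> (\<Sum>i<n. \<Sum>j<n. (cmod (r i $ j))\<^sup>2)"
    by (intro sum_mono sq[OF B]) (simp add: r_def)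
  also have "\<dots> = (vec_norm2 z)\<^sup>2" using vec_norm2_sq_pair[OF z] by (simp add: r_def)
  finally show "vec_norm2 (kronecker A B *\<^sub>v z) \<le> vec_norm2 z" by (rule power2_le_imp_le) simp
qed

lemma kronecker_mult:
  assumes A: "A \<in> carrier_mat n n" "B \<in> carrier_mat n n" and C: "C \<in> carrier_mat n n" "D \<in> carrier_mat n n"
  shows "kronecker A B * kronecker C D = kronecker (A * C) (B * D)"
proof (rule eq_matI)
  note AC = mult_carrier_mat[OF A(1) C(1)] and BD = mult_carrier_mat[OF A(2) C(2)]
  note KA = kronecker_carrier[OF A] and KC = kronecker_carrier[OF C] and KP = kronecker_carrier[OF AC BD]
  fix p q assume "p < dim_row (kronecker (A * C) (B * D))" "q < dim_col (kronecker (A * C) (B * D))"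
  then have pq: "p < n * n" "q < n * n" using KP by auto
  obtain i j where p: "p = i * n + j" "i < n" "j < n" using pair_index_cases[OF pq(1)] .
  obtain i' j' where q: "q = i' * n + j'" "i' < n" "j' < n" using pair_index_cases[OF pq(2)] .
  have "(kronecker A B * kronecker C D) $$ (p, q) = (\<Sum>l<n * n. kronecker A B $$ (p, l) * kronecker C D $$ (l, q))"
    using KA KC pq by (simp add: scalar_prod_def lessThan_atLeast0)
  also have "\<dots> = (\<Sum>k<n. \<Sum>l<n. (A $$ (i, k) * C $$ (k, i')) * (B $$ (j, l) * D $$ (l, j')))"
    unfolding sum_pair_index p(1) q(1)
    by (intro sum.cong refl) (simp add: kronecker_index[OF A p(2,3)] kronecker_index[OF C _ _ q(2,3)] mult_ac)
  also have "\<dots> = (A * C) $$ (i, i') * (B * D) $$ (j, j')"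
    using A C p q by (simp add: sum_product[symmetric] scalar_prod_def lessThan_atLeast0)
  finally show "(kronecker A B * kronecker C D) $$ (p, q) = kronecker (A * C) (B * D) $$ (p, q)"
    unfolding p(1) q(1) kronecker_index[OF AC BD p(2,3) q(2,3)] .
qed (use A C in \<open>auto simp: kronecker_def\<close>)

text \<open>The induction starts at exponent 1, where there is nothing to prove; exponent 0 would
  involve the Kronecker product of identity matrices.\<close>

lemma kronecker_pow_Suc:
  assumes A: "A \<in> carrier_mat n n" "B \<in> carrier_mat n n"
  shows "kronecker A B ^\<^sub>m Suc k = kronecker (A ^\<^sub>m Suc k) (B ^\<^sub>m Suc k)"
proof (induction k)
  case 0
  then show ?case using A kronecker_carrier[OF A] by simp
next
  case (Suc k)
  then show ?case
    using kronecker_mult[OF pow_carrier_mat[OF A(1), of "Suc k"] pow_carrier_mat[OF A(2), of "Suc k"] A] by simp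
qed

lemma kronecker_pow_mult_kronecker_vec:
  assumes A: "A \<in> carrier_mat n n" "B \<in> carrier_mat n n" and x: "x \<in> carrier_vec n" "y \<in> carrier_vec n"
  shows "kronecker A B ^\<^sub>m k *\<^sub>v kronecker_vec n x y = kronecker_vec n (A ^\<^sub>m k *\<^sub>v x) (B ^\<^sub>m k *\<^sub>v y)"
proof (cases k)
  case 0
  then show ?thesis using A x carrier_matD(1)[OF kronecker_carrier[OF A]] by simp
next
  case (Suc l)
  show ?thesis unfolding Suc kronecker_pow_Suc[OF A]
    by (rule kronecker_mult_kronecker_vec[OF pow_carrier_mat[OF A(1)] pow_carrier_mat[OF A(2)] x])
qed

lemma kronecker_vec_smult:
  assumes "x \<in> carrier_vec n" "y \<in> carrier_vec n"
  shows "kronecker_vec n (c \<cdot>\<^sub>v x) (d \<cdot>\<^sub>v y) = (c * d) \<cdot>\<^sub>v kronecker_vec n x y"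
  by (rule eq_vec_pairI[of _ n]) (use assms in \<open>auto simp: kronecker_vec_index pair_index_less kronecker_vec_carrier[THEN carrier_vecD]\<close>)

lemma kronecker_zero: "kronecker (0\<^sub>m n n) (0\<^sub>m n n) = 0\<^sub>m (n * n) (n * n)"
proof (rule eq_matI)
  fix p q assume "p < dim_row (0\<^sub>m (n * n) (n * n) :: complex mat)" "q < dim_col (0\<^sub>m (n * n) (n * n) :: complex mat)"
  then have "p < n * n" "q < n * n" by auto
  moreover from this have "n > 0" by (cases n) auto
  moreover from calculation have "p div n < n" "p mod n < n" "q div n < n" "q mod n < n"
    by (auto intro: less_mult_imp_div_less)
  ultimately show "kronecker (0\<^sub>m n n) (0\<^sub>m n n) $$ (p, q) = 0\<^sub>m (n * n) (n * n) $$ (p, q)"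
    by (simp add: kronecker_def)
qed (simp_all add: kronecker_def)

lemma kronecker_norm_attaining_nilpotent:
  assumes "norm_attaining_nilpotent n k T x"
  shows "norm_attaining_nilpotent (n * n) k (kronecker T T) (kronecker_vec n x x)"
proof -
  interpret norm_attaining_nilpotent n k T x by fact
  show ?thesis
  proof
    show "contraction (n * n) (kronecker T T)" by (rule kronecker_contraction[OF T T])
    show "kronecker T T ^\<^sub>m Suc k = 0\<^sub>m (n * n) (n * n)"
      unfolding kronecker_pow_Suc[OF TC TC] nil by (rule kronecker_zero)
    show "vec_norm2 (kronecker_vec n x x) = 1" using x by (simp add: vec_norm2_kronecker_vec)
    show "vec_norm2 (kronecker T T ^\<^sub>m k *\<^sub>v kronecker_vec n x x) = 1"
      unfolding kronecker_pow_mult_kronecker_vec[OF TC TC x(1) x(1)]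
      using Tk x by (simp add: vec_norm2_kronecker_vec)
  qed simp
qed

subsection \<open>The power indices\<close>

text \<open>A common description of both indices. Their defining properties pass to smaller
  exponents, so a finite supremum is attained and the property fails at the very next
  exponent.\<close>

lemma Sup_downward_closed:
  fixes Q :: "nat \<Rightarrow> bool"
  assumes "Q 1" and down: "\<And>j k. Q k \<Longrightarrow> j \<le> k \<Longrightarrow> Q j"
  obtains "\<And>k. Q k" "Sup {enat k | k. 1 \<le> k \<and> Q k} = \<infinity>"
  | m where "1 \<le> m" "Q m" "\<not> Q (Suc m)" "Sup {enat k | k. 1 \<le> k \<and> Q k} = enat m"
proof (cases "\<forall>k. Q k")
  case True
  have "Sup {enat k | k. 1 \<le> k \<and> Q k} = \<infinity>"
  proof (rule ccontr)
    assume "Sup {enat k | k. 1 \<le> k \<and> Q k} \<noteq> \<infinity>"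
    then obtain m where m: "Sup {enat k | k. 1 \<le> k \<and> Q k} = enat m" by (cases "Sup {enat k | k. 1 \<le> k \<and> Q k}") auto
    have "enat (Suc m) \<le> Sup {enat k | k. 1 \<le> k \<and> Q k}" by (rule Sup_upper) (use True in auto)
    then show False using m by simp
  qed
  then show thesis using that(1) True by blast
next
  case False
  then obtain k where "\<not> Q k" by blast
  \<comment> \<open>The least failure is at least 2, since Q holds at 1 and therefore at 0; hence
    its predecessor m is at least 1 and still satisfies Q.\<close>
  define m where "m = (LEAST k. \<not> Q k) - 1"
  have L: "\<not> Q (LEAST k. \<not> Q k)" by (rule LeastI) fact
  have "(LEAST k. \<not> Q k) \<ge> 2"
  proof (rule ccontr)
    assume "\<not> 2 \<le> (LEAST k. \<not> Q k)"
    then show False using L down[OF \<open>Q 1\<close>, of "LEAST k. \<not> Q k"] by simp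
  qed
  then have m: "Suc m = (LEAST k. \<not> Q k)" "1 \<le> m" by (simp_all add: m_def)
  have Qm: "Q m" using not_less_Least[of m "\<lambda>k. \<not> Q k"] m(1) by auto
  have nQ: "\<not> Q (Suc m)" using L m by simp
  have "Sup {enat k | k. 1 \<le> k \<and> Q k} = enat m"
  proof (rule antisym)
    show "Sup {enat k | k. 1 \<le> k \<and> Q k} \<le> enat m"
    proof (rule Sup_least)
      fix e assume "e \<in> {enat k | k. 1 \<le> k \<and> Q k}"
      then obtain k where k: "e = enat k" "Q k" by auto
      then have "k \<le> m" using nQ down[OF k(2), of "Suc m"] by (meson not_less_eq_eq)
      then show "e \<le> enat m" using k by simp
    qed
    show "enat m \<le> Sup {enat k | k. 1 \<le> k \<and> Q k}" by (rule Sup_upper) (use m Qm in auto)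
  qed
  then show thesis using that(2) m(2) Qm nQ by blast
qed

lemma diag_block_pair:
  fixes C D :: "complex mat"
  assumes "C \<in> carrier_mat p p" "D \<in> carrier_mat q q"
  shows "diag_block_mat [C, D] = four_block_mat C (0\<^sub>m p q) (0\<^sub>m q p) D"
  unfolding diag_block_mat.simps(2)[of C "[D]"] diag_block_mat_singleton Let_def using assms by simp

section \<open>Matrices of norm one: both equivalent conditions and the Kronecker square\<close>

locale norm_one_mat =
  fixes n :: nat and A :: "complex mat"
  assumes A: "A \<in> carrier_mat n n" and norm: "op_norm A = 1"
begin

lemma contr: "contraction n A"
  by (rule op_norm_1_contraction[OF A norm])

text \<open>The empty matrix has norm 0. Positive size is what makes the spectrum nonempty
  later.\<close>

lemma size_pos: "n > 0"
proof (rule ccontr)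
  assume "\<not> n > 0"
  then have "op_norm A \<le> 0"
    by (intro op_norm_least[OF A]) (use A in \<open>auto simp: vec_norm2_def cscalar_prod_eq_sum\<close>)
  then show False using norm by simp
qed

lemma op_norm_pow_1: "op_norm (A ^\<^sub>m 1) = 1"
  using norm A by simp

text \<open>A unit vector at which the k-th power attains norm 1 loses no norm at any earlier
  exponent.\<close>

lemma op_norm_pow_antimono:
  assumes "op_norm (A ^\<^sub>m k) = 1" "j \<le> k"
  shows "op_norm (A ^\<^sub>m j) = 1"
proof -
  obtain x where x: "x \<in> carrier_vec n" "vec_norm2 x = 1" "vec_norm2 (A ^\<^sub>m k *\<^sub>v x) = 1"
    using contraction_op_norm_attained[OF contraction_pow[OF contr] assms(1)] .
  have "vec_norm2 (A ^\<^sub>m j *\<^sub>v x) = 1"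
    using vec_norm2_pow_antimono[OF contr x(1) \<open>j \<le> k\<close>] contractionD[OF contraction_pow[OF contr, of j] x(1)] x by simp
  then show ?thesis by (rule op_norm_eq_1[OF contraction_pow[OF contr] x(1,2)])
qed

lemma pow_zero_mono:
  assumes "A ^\<^sub>m j = 0\<^sub>m n n" "j \<le> k"
  shows "A ^\<^sub>m k = 0\<^sub>m n n"
  using \<open>j \<le> k\<close>
proof (induction k rule: dec_induct)
  case (step k)
  then show ?case using A by simp
qed fact

text \<open>The usable form of p_A <= n_A.\<close>

lemma op_norm_pow_imp_nonzero: "op_norm (A ^\<^sub>m k) = 1 \<Longrightarrow> A ^\<^sub>m k \<noteq> 0\<^sub>m n n"
  using op_norm_least[of "0\<^sub>m n n" n 0] by fastforce

lemma norm_power_index_cases: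
  obtains "\<And>k. op_norm (A ^\<^sub>m k) = 1" "norm_power_index A = \<infinity>"
  | m where "1 \<le> m" "op_norm (A ^\<^sub>m m) = 1" "op_norm (A ^\<^sub>m Suc m) \<noteq> 1" "norm_power_index A = enat m"
proof -
  have eq: "norm_power_index A = Sup {enat k | k. 1 \<le> k \<and> op_norm (A ^\<^sub>m k) = 1}"
    by (simp add: norm_power_index_def norm)
  show thesis
    by (rule Sup_downward_closed[of "\<lambda>k. op_norm (A ^\<^sub>m k) = 1"])
      (use op_norm_pow_1 op_norm_pow_antimono that eq in auto)
qed

lemma nonzero_power_index_cases:
  obtains "\<And>k. A ^\<^sub>m k \<noteq> 0\<^sub>m n n" "nonzero_power_index A = \<infinity>"
  | m where "1 \<le> m" "A ^\<^sub>m m \<noteq> 0\<^sub>m n n" "A ^\<^sub>m Suc m = 0\<^sub>m n n" "nonzero_power_index A = enat m"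
proof -
  have 1: "A ^\<^sub>m 1 \<noteq> 0\<^sub>m n n" by (rule op_norm_pow_imp_nonzero[OF op_norm_pow_1])
  have eq: "nonzero_power_index A = Sup {enat k | k. 1 \<le> k \<and> A ^\<^sub>m k \<noteq> 0\<^sub>m n n}"
    using 1 A by (simp add: nonzero_power_index_def)
  show thesis
  proof (rule Sup_downward_closed[of "\<lambda>k. A ^\<^sub>m k \<noteq> 0\<^sub>m n n"])
    show "A ^\<^sub>m j \<noteq> 0\<^sub>m n n" if "A ^\<^sub>m k \<noteq> 0\<^sub>m n n" "j \<le> k" for j k
      using pow_zero_mono that by blast
  next
    assume Q: "\<And>k. A ^\<^sub>m k \<noteq> 0\<^sub>m n n" and S: "Sup {enat k | k. 1 \<le> k \<and> A ^\<^sub>m k \<noteq> 0\<^sub>m n n} = \<infinity>"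
    from Q S[folded eq] show thesis by (rule that(1))
  next
    fix m assume Q: "1 \<le> m" "A ^\<^sub>m m \<noteq> 0\<^sub>m n n" "\<not> A ^\<^sub>m Suc m \<noteq> 0\<^sub>m n n"
      and S: "Sup {enat k | k. 1 \<le> k \<and> A ^\<^sub>m k \<noteq> 0\<^sub>m n n} = enat m"
    from Q(1,2) Q(3)[unfolded not_not] S[folded eq] show thesis by (rule that(2))
  qed (fact 1)
qed

text \<open>When the common value m is finite, p_A = m supplies a vector whose norm the m-th power
  preserves, and n_A = m makes the next power zero; together these are the locale
  assumptions.\<close>

lemma indices_eq_cases:
  assumes "norm_power_index A = nonzero_power_index A"
  obtains "\<And>k. op_norm (A ^\<^sub>m k) = 1"
  | k x where "norm_power_index A = enat k" "norm_attaining_nilpotent n k A x"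
proof (rule norm_power_index_cases)
  fix m assume m: "op_norm (A ^\<^sub>m m) = 1" "norm_power_index A = enat m"
  have nil: "A ^\<^sub>m Suc m = 0\<^sub>m n n"
    by (rule nonzero_power_index_cases) (use assms m in auto)
  obtain x where x: "x \<in> carrier_vec n" "vec_norm2 x = 1" "vec_norm2 (A ^\<^sub>m m *\<^sub>v x) = 1"
    using contraction_op_norm_attained[OF contraction_pow[OF contr] m(1)] .
  have "norm_attaining_nilpotent n m A x" by unfold_locales (fact contr nil x)+
  then show thesis using that(2) m(2) by blast
qed (use that(1) in blast)

lemma indices_infinite:
  assumes "\<And>k. op_norm (A ^\<^sub>m k) = 1"
  shows "norm_power_index A = nonzero_power_index A"
proof -
  have "norm_power_index A = \<infinity>" by (rule norm_power_index_cases) (use assms in \<open>auto simp del: pow_mat.simps\<close>)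
  moreover have "nonzero_power_index A = \<infinity>"
    by (rule nonzero_power_index_cases) (use op_norm_pow_imp_nonzero[OF assms] in \<open>auto simp del: pow_mat.simps\<close>)
  ultimately show ?thesis by simp
qed

text \<open>All powers of the unitary summand are isometric, so a unit vector supported on it,
  transported by the unitary similarity, keeps norm 1 under every power of A.\<close>

lemma unitary_part_imp_op_norm_pow:
  assumes "has_unitary_part A"
  shows "op_norm (A ^\<^sub>m k) = 1"
proof -
  obtain U A' where U: "unitary_mat U" "1 \<le> dim_row U" and sq: "square_mat A'"
    and sim: "unitarily_similar A (diag_block_mat [U, A'])"
    using assms by (auto simp: has_unitary_part_def)
  define p where "p = dim_row U"
  define q where "q = dim_row A'"
  have UC: "U \<in> carrier_mat p p" using U by (auto simp: unitary_mat_def p_def)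
  have AC: "A' \<in> carrier_mat q q" using sq by (auto simp: q_def)
  let ?D = "diag_block_mat [U, A']"
  obtain W where W: "unitary_mat W" and wit: "similar_mat_wit A ?D W (mat_adjoint W)"
    using sim by (auto simp: unitarily_similar_def)
  note w = similar_mat_witD2[OF A wit]
  have "?D \<in> carrier_mat (p + q) (p + q)" using UC AC by (auto simp: Let_def)
  then have npq: "n = p + q" using w(5) by auto
  have iso: "vec_norm2 (V *\<^sub>v x) = vec_norm2 x"
    if V: "V \<in> carrier_mat m m" "mat_adjoint V * V = 1\<^sub>m m" and x: "x \<in> carrier_vec m" for V m and x :: "complex vec"
  proof -
    have "mat_adjoint V *\<^sub>v (V *\<^sub>v x) = x"
      using assoc_mult_mat_vec[OF mat_adjoint_carrier[OF V(1)] V(1) x] V(2) x by simp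
    then have "(V *\<^sub>v x) \<bullet>c (V *\<^sub>v x) = x \<bullet>c x"
      using mat_adjoint_cscalar_prod[OF V(1) mult_mat_vec_carrier[OF V(1) x] x] by simp
    then show ?thesis by (simp add: vec_norm2_def)
  qed
  have UU: "mat_adjoint U * U = 1\<^sub>m p" using U UC by (simp add: unitary_mat_def inverts_mat_def)
  have Upow: "vec_norm2 (U ^\<^sub>m k *\<^sub>v x) = vec_norm2 x" if x: "x \<in> carrier_vec p" for x
  proof (induction k)
    case (Suc k)
    show ?case unfolding pow_Suc_mult_vec[OF UC x]
      using iso[OF UC UU mult_mat_vec_carrier[OF pow_carrier_mat[OF UC] x]] Suc by simp
  qed (use UC x in simp)
  have zero_ext: "vec_norm2 (x @\<^sub>v 0\<^sub>v q) = vec_norm2 x" if "x \<in> carrier_vec p" for x :: "complex vec"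
  proof -
    have "(x @\<^sub>v 0\<^sub>v q) \<bullet>c (x @\<^sub>v 0\<^sub>v q) = x \<bullet>c x"
    proof -
      have "conjugate (x @\<^sub>v 0\<^sub>v q) = conjugate x @\<^sub>v 0\<^sub>v q" using that by (intro eq_vecI) auto
      then show ?thesis using that scalar_prod_append[of x p "0\<^sub>v q" q "conjugate x" "0\<^sub>v q"] by simp
    qed
    then show ?thesis by (simp add: vec_norm2_def)
  qed
  let ?e = "unit_vec p 0 :: complex vec"
  have e: "?e \<in> carrier_vec p" "vec_norm2 ?e = 1" using U(2) by (simp_all add: vec_norm2_def p_def)
  let ?z = "?e @\<^sub>v 0\<^sub>v q"
  have z: "?z \<in> carrier_vec n" unfolding npq by (rule append_carrier_vec) simp_all
  have zn: "vec_norm2 ?z = 1" using zero_ext[OF e(1)] e(2) by simp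
  have Dk: "?D ^\<^sub>m k *\<^sub>v ?z = (U ^\<^sub>m k *\<^sub>v ?e) @\<^sub>v 0\<^sub>v q"
  proof -
    have "?D ^\<^sub>m k = four_block_mat (U ^\<^sub>m k) (0\<^sub>m p q) (0\<^sub>m q p) (A' ^\<^sub>m k)"
      unfolding diag_block_pair[OF UC AC] by (rule pow_four_block_mat[OF UC AC])
    then show ?thesis
      using four_block_mat_mult_vec[OF pow_carrier_mat[OF UC] zero_carrier_mat zero_carrier_mat pow_carrier_mat[OF AC]
          e(1) zero_carrier_vec, of k k]
        mat_mult_zero_vec[OF pow_carrier_mat[OF AC, of k]]
        mult_mat_vec_carrier[OF pow_carrier_mat[OF UC, of k] e(1)] e(1) by simp
  qed
  have Dn: "vec_norm2 (?D ^\<^sub>m k *\<^sub>v ?z) = 1"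
    unfolding Dk using zero_ext[OF mult_mat_vec_carrier[OF pow_carrier_mat[OF UC] e(1)]] Upow[OF e(1)] e(2) by simp
  have Wz: "W *\<^sub>v ?z \<in> carrier_vec n" by (rule mult_mat_vec_carrier[OF w(6) z])
  have Dc: "?D ^\<^sub>m k \<in> carrier_mat n n" by (rule pow_carrier_mat[OF w(5)])
  have Dz: "?D ^\<^sub>m k *\<^sub>v ?z \<in> carrier_vec n" by (rule mult_mat_vec_carrier[OF Dc z])
  have "A ^\<^sub>m k *\<^sub>v (W *\<^sub>v ?z) = W *\<^sub>v (?D ^\<^sub>m k *\<^sub>v (mat_adjoint W *\<^sub>v (W *\<^sub>v ?z)))"
    using similar_mat_wit_pow_id[OF wit, of k] assoc_mult_mat_vec[OF mult_carrier_mat[OF w(6) Dc] w(7) Wz]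
      assoc_mult_mat_vec[OF w(6) Dc mult_mat_vec_carrier[OF w(7) Wz]] by simp
  also have "mat_adjoint W *\<^sub>v (W *\<^sub>v ?z) = ?z"
    using assoc_mult_mat_vec[OF w(7) w(6) z] w(2) z by simp
  finally have "vec_norm2 (A ^\<^sub>m k *\<^sub>v (W *\<^sub>v ?z)) = 1"
    using iso[OF w(6,2) Dz] Dn by simp
  moreover have "vec_norm2 (W *\<^sub>v ?z) = 1" using iso[OF w(6,2) z] zn by simp
  ultimately show ?thesis using op_norm_eq_1[OF contraction_pow[OF contr] Wz] by blast
qed

lemma pow_zero_if_nilpotent_blocks:
  assumes B: "B \<in> carrier_mat (n - k - 1) (n - k - 1)" "B ^\<^sub>m (k + 1) = 0\<^sub>m (n - k - 1) (n - k - 1)"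
    and "k + 1 \<le> n" and sim: "unitarily_similar A (diag_block_mat [jordan_block (k + 1) 0, B])"
  shows "A ^\<^sub>m (k + 1) = 0\<^sub>m n n"
proof -
  let ?J = "jordan_block (k + 1) (0::complex)" and ?q = "n - k - 1"
  have JC: "?J \<in> carrier_mat (k + 1) (k + 1)" by simp
  obtain W where wit: "similar_mat_wit A (diag_block_mat [?J, B]) W (mat_adjoint W)"
    using sim by (auto simp: unitarily_similar_def)
  note w = similar_mat_witD2[OF A wit]
  have "?J ^\<^sub>m (k + 1) = 0\<^sub>m (k + 1) (k + 1)"
    unfolding jordan_block_zero_pow by (intro eq_matI) auto
  then have "diag_block_mat [?J, B] ^\<^sub>m (k + 1) = four_block_mat (0\<^sub>m (k + 1) (k + 1)) (0\<^sub>m (k + 1) ?q) (0\<^sub>m ?q (k + 1)) (0\<^sub>m ?q ?q)"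
    unfolding diag_block_pair[OF JC B(1)] using pow_four_block_mat[OF JC B(1), of "k + 1"] B(2) by (simp del: pow_mat.simps)
  also have "\<dots> = 0\<^sub>m n n" using \<open>k + 1 \<le> n\<close> by (intro eq_matI) auto
  finally show ?thesis
    using similar_mat_wit_pow_id[OF wit, of "k + 1"] w(6,7) by simp
qed

theorem indices_eq_iff:
  "norm_power_index A = nonzero_power_index A \<longleftrightarrow>
     has_unitary_part A \<or>
     (\<exists>k B. norm_power_index A = enat k \<and> k + 1 \<le> n \<and> B \<in> carrier_mat (n - k - 1) (n - k - 1) \<and>
        B ^\<^sub>m (k + 1) = 0\<^sub>m (n - k - 1) (n - k - 1) \<and>
        unitarily_similar A (diag_block_mat [jordan_block (k + 1) 0, B]))"
    (is "?L \<longleftrightarrow> ?U \<or> ?J")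
proof
  assume ?L
  then show "?U \<or> ?J"
  proof (rule indices_eq_cases)
    assume *: "\<And>k. op_norm (A ^\<^sub>m k) = 1"
    obtain c x where cx: "cmod c = 1" "x \<in> carrier_vec n" "vec_norm2 x = 1" "A *\<^sub>v x = c \<cdot>\<^sub>v x"
      using contraction_unimodular_eigenvector[OF contr size_pos *] .
    then show ?thesis using contraction_unitary_part[OF contr cx] by blast
  next
    fix k x assume k: "norm_power_index A = enat k" and "norm_attaining_nilpotent n k A x"
    then interpret norm_attaining_nilpotent n k A x by simp
    let ?J = "jordan_block (Suc k) (0::complex)" and ?q = "n - Suc k"
    obtain B where B: "Suc k \<le> n" "B \<in> carrier_mat ?q ?q"
      "unitarily_similar A (diag_block_mat [?J, B])"
      by (rule jordan_block_summand)
    obtain W where "similar_mat_wit A (diag_block_mat [?J, B]) W (mat_adjoint W)"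
      using B(3) by (auto simp: unitarily_similar_def)
    \<comment> \<open>Reversing the similarity carries the vanishing of the power from A to the
      block matrix, where the power of B can be read off in the lower right corner.\<close>
    note wit = similar_mat_wit_sym[OF this]
    have DC: "diag_block_mat [?J, B] \<in> carrier_mat n n" using B(1,2) by (auto simp: Let_def)
    note w = similar_mat_witD2[OF DC wit]
    have "diag_block_mat [?J, B] ^\<^sub>m Suc k = 0\<^sub>m n n"
      using similar_mat_wit_pow_id[OF wit, of "Suc k"] w(6,7) nil by (simp del: pow_mat.simps)
    moreover have "diag_block_mat [?J, B] ^\<^sub>m Suc k
        = four_block_mat (?J ^\<^sub>m Suc k) (0\<^sub>m (Suc k) ?q) (0\<^sub>m ?q (Suc k)) (B ^\<^sub>m Suc k)"
      unfolding diag_block_pair[OF jordan_block_carrier B(2)] by (rule pow_four_block_mat[OF jordan_block_carrier B(2)])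
    ultimately have zero: "four_block_mat (?J ^\<^sub>m Suc k) (0\<^sub>m (Suc k) ?q) (0\<^sub>m ?q (Suc k)) (B ^\<^sub>m Suc k) = 0\<^sub>m n n"
      by simp
    have "B ^\<^sub>m Suc k = 0\<^sub>m ?q ?q"
    proof (rule eq_matI)
      fix i j assume "i < dim_row (0\<^sub>m ?q ?q :: complex mat)" "j < dim_col (0\<^sub>m ?q ?q :: complex mat)"
      then have ij: "i < ?q" "j < ?q" by auto
      have "four_block_mat (?J ^\<^sub>m Suc k) (0\<^sub>m (Suc k) ?q) (0\<^sub>m ?q (Suc k)) (B ^\<^sub>m Suc k) $$ (i + Suc k, j + Suc k)
          = (B ^\<^sub>m Suc k) $$ (i, j)"
        using ij B(2) by (simp add: index_mat_four_block del: pow_mat.simps)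
      then show "(B ^\<^sub>m Suc k) $$ (i, j) = 0\<^sub>m ?q ?q $$ (i, j)"
        unfolding zero using ij by simp
    qed (use pow_carrier_mat[OF B(2), of "Suc k"] in \<open>auto simp del: pow_mat.simps\<close>)
    then show ?thesis using k B by (auto simp del: pow_mat.simps intro!: exI[of _ k] exI[of _ B])
  qed
next
  assume "?U \<or> ?J"
  then show ?L
  proof
    assume ?U
    then show ?L by (intro indices_infinite unitary_part_imp_op_norm_pow)
  next
    assume ?J
    then obtain k B where k: "norm_power_index A = enat k" and B: "k + 1 \<le> n" "B \<in> carrier_mat (n - k - 1) (n - k - 1)"
        "B ^\<^sub>m (k + 1) = 0\<^sub>m (n - k - 1) (n - k - 1)"
        "unitarily_similar A (diag_block_mat [jordan_block (k + 1) 0, B])"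
      by blast
    have z: "A ^\<^sub>m (k + 1) = 0\<^sub>m n n" by (rule pow_zero_if_nilpotent_blocks[OF B(2,3,1,4)])
    \<comment> \<open>As k is p_A, the k-th power has norm 1. With the vanishing of the next power
      this pins n_A to k.\<close>
    have nz: "A ^\<^sub>m k \<noteq> 0\<^sub>m n n"
      by (rule norm_power_index_cases) (use k op_norm_pow_imp_nonzero in auto)
    show ?L
    proof (rule nonzero_power_index_cases)
      assume "\<And>k. A ^\<^sub>m k \<noteq> 0\<^sub>m n n"
      then show ?thesis using z by blast
    next
      fix m assume m: "A ^\<^sub>m m \<noteq> 0\<^sub>m n n" "A ^\<^sub>m Suc m = 0\<^sub>m n n" "nonzero_power_index A = enat m"
      have "m < k + 1" using pow_zero_mono[OF z, of m] m(1) by (meson not_le)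
      moreover have "k < Suc m" using pow_zero_mono[OF m(2), of k] nz by (meson not_le)
      ultimately show ?thesis using k m(3) by simp
    qed
  qed
qed

text \<open>In the infinite case x tensor x is an eigenvector of the Kronecker square for c^2, which
  is again unimodular.\<close>

theorem numerical_radius_kronecker:
  assumes "norm_power_index A = nonzero_power_index A"
  shows "numerical_radius (kronecker A A) = numerical_radius A"
  using assms
proof (rule indices_eq_cases)
  assume *: "\<And>k. op_norm (A ^\<^sub>m k) = 1"
  obtain c x where cx: "cmod c = 1" "x \<in> carrier_vec n" "vec_norm2 x = 1" "A *\<^sub>v x = c \<cdot>\<^sub>v x"
    using contraction_unimodular_eigenvector[OF contr size_pos *] .
  have "numerical_radius (kronecker A A) = 1"
  proof (rule numerical_radius_unimodular_eigenvector[OF kronecker_contraction[OF contr contr]])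
    show "cmod (c * c) = 1" using cx(1) by (simp add: norm_mult)
    show "vec_norm2 (kronecker_vec n x x) = 1" using cx by (simp add: vec_norm2_kronecker_vec)
    show "kronecker A A *\<^sub>v kronecker_vec n x x = (c * c) \<cdot>\<^sub>v kronecker_vec n x x"
      unfolding kronecker_mult_kronecker_vec[OF A A cx(2,2)] cx(4) by (rule kronecker_vec_smult[OF cx(2,2)])
  qed simp
  then show ?thesis using numerical_radius_unimodular_eigenvector[OF contr cx] by simp
next
  fix k x assume kx: "norm_attaining_nilpotent n k A x"
  show ?thesis
    using norm_attaining_nilpotent.numerical_radius_eq_jordan_block[OF kx]
      norm_attaining_nilpotent.numerical_radius_eq_jordan_block[OF kronecker_norm_attaining_nilpotent[OF kx]] by simp
qed

end

subsection \<open>The counterexample\<close>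

text \<open>The counterexample to the converse in (b) is \<open>J\<^sub>2 \<oplus> [1/2]\<close>: the second summand makes the powers
  nonzero without affecting either numerical radius.\<close>
definition counterexample :: "complex mat" where
  "counterexample = mat 3 3 (\<lambda>(i, j). if i = 0 \<and> j = 1 then 1 else if i = 2 \<and> j = 2 then 1 / 2 else 0)"

lemma counterexample_carrier: "counterexample \<in> carrier_mat 3 3"
  by (simp add: counterexample_def)

lemma sum_lessThan_3: "(\<Sum>i<(3::nat). f i) = f 0 + f (Suc 0) + f 2"
  by (simp add: eval_nat_numeral)

lemma counterexample_mult_vec:
  assumes "x \<in> carrier_vec 3"
  shows "(counterexample *\<^sub>v x) $ 0 = x $ Suc 0" "(counterexample *\<^sub>v x) $ Suc 0 = 0" "(counterexample *\<^sub>v x) $ 2 = x $ 2 / 2"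
  using assms by (simp_all add: counterexample_def scalar_prod_def lessThan_atLeast0[symmetric] sum_lessThan_3)

lemma vec_norm2_sq_3: "x \<in> carrier_vec 3 \<Longrightarrow> (vec_norm2 x)\<^sup>2 = (cmod (x $ 0))\<^sup>2 + (cmod (x $ Suc 0))\<^sup>2 + (cmod (x $ 2))\<^sup>2"
  by (simp add: vec_norm2_sq sum_lessThan_3)

lemma counterexample_vec [simp]: "x \<in> carrier_vec 3 \<Longrightarrow> counterexample *\<^sub>v x \<in> carrier_vec 3"
  by (rule mult_mat_vec_carrier[OF counterexample_carrier])

lemma counterexample_contraction: "contraction 3 counterexample"
  unfolding contraction_def
proof (intro conjI ballI counterexample_carrier)
  fix x :: "complex vec" assume x: "x \<in> carrier_vec 3"
  have "(vec_norm2 (counterexample *\<^sub>v x))\<^sup>2 \<le> (vec_norm2 x)\<^sup>2"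
    using x by (simp add: vec_norm2_sq_3 counterexample_mult_vec norm_divide power_divide)
  then show "vec_norm2 (counterexample *\<^sub>v x) \<le> vec_norm2 x" by (rule power2_le_imp_le) simp
qed

lemma counterexample_op_norm: "op_norm counterexample = 1"
proof (rule op_norm_eq_1[OF counterexample_contraction])
  let ?e = "unit_vec 3 1 :: complex vec"
  show "vec_norm2 ?e = 1" by (simp add: vec_norm2_def)
  have "(vec_norm2 (counterexample *\<^sub>v ?e))\<^sup>2 = 1"
    by (simp add: vec_norm2_sq_3 counterexample_mult_vec)
  then show "vec_norm2 (counterexample *\<^sub>v ?e) = 1"
    unfolding power2_eq_1_iff using vec_norm2_nonneg[of "counterexample *\<^sub>v ?e"] by linarith
qed simp

interpretation counterexample: norm_one_mat 3 counterexample
  by unfold_locales (fact counterexample_carrier counterexample_op_norm)+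

lemma counterexample_indices: "norm_power_index counterexample \<noteq> nonzero_power_index counterexample"
proof -
  let ?A = counterexample
  \<comment> \<open>Squaring removes the Jordan block and leaves the entry 1/4; any bound below 1
    suffices to make p_A finite.\<close>
  have "op_norm (?A ^\<^sub>m 2) \<le> 1 / 2"
  proof (rule op_norm_least[OF pow_carrier_mat[OF counterexample_carrier]])
    fix x :: "complex vec" assume x: "x \<in> carrier_vec 3"
    have "?A ^\<^sub>m 2 *\<^sub>v x = ?A *\<^sub>v (?A *\<^sub>v x)"
      using pow_add_mult_vec[OF counterexample_carrier x, of 1 1] counterexample_carrier
      by (simp add: numeral_2_eq_2)
    then have "(vec_norm2 (?A ^\<^sub>m 2 *\<^sub>v x))\<^sup>2 \<le> (1 / 2 * vec_norm2 x)\<^sup>2"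
      using x by (simp add: vec_norm2_sq_3 counterexample_mult_vec norm_divide power_divide power_mult_distrib)
    then show "vec_norm2 (?A ^\<^sub>m 2 *\<^sub>v x) \<le> 1 / 2 * vec_norm2 x" by (rule power2_le_imp_le) simp
  qed simp
  then have n2: "op_norm (?A ^\<^sub>m 2) \<noteq> 1" by simp
  have "norm_power_index ?A \<noteq> \<infinity>"
    by (rule counterexample.norm_power_index_cases) (use n2 in auto)
  moreover have nz: "?A ^\<^sub>m k \<noteq> 0\<^sub>m 3 3" for k
  proof
    let ?e = "unit_vec 3 2 :: complex vec"
    have "(?A ^\<^sub>m k *\<^sub>v ?e) $ 2 = (1 / 2) ^ k"
    proof (induction k)
      case 0
      then show ?case using counterexample_carrier by simp
    next
      case (Suc k)
      have "?A ^\<^sub>m k *\<^sub>v ?e \<in> carrier_vec 3"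
        by (rule mult_mat_vec_carrier[OF pow_carrier_mat[OF counterexample_carrier]]) simp
      then show ?case
        using Suc by (simp add: pow_Suc_mult_vec[OF counterexample_carrier] counterexample_mult_vec del: pow_mat.simps)
    qed
    moreover assume "?A ^\<^sub>m k = 0\<^sub>m 3 3"
    ultimately show False by simp
  qed
  have "nonzero_power_index ?A = \<infinity>"
    by (rule counterexample.nonzero_power_index_cases) (use nz in \<open>auto simp del: pow_mat.simps\<close>)
  ultimately show ?thesis by simp
qed

lemma cmod_mult_cnj_le: "cmod (a * cnj b) \<le> ((cmod a)\<^sup>2 + (cmod b)\<^sup>2) / 2"
  using sum_squares_bound[of "cmod a" "cmod b"] by (simp add: norm_mult)

text \<open>Here w(J_2) = 1/2 decides, and 1/2 is the largest modulus of the extra entry that does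
  not raise it. The two terms of the form involve disjoint sets of coordinates, so their bounds by
  the arithmetic-geometric mean inequality add up to half the squared norm.\<close>

lemma counterexample_numerical_radius: "numerical_radius counterexample = 1 / 2"
proof (rule antisym)
  let ?A = counterexample
  have form: "(?A *\<^sub>v x) \<bullet>c x = x $ Suc 0 * cnj (x $ 0) + x $ 2 * cnj (x $ 2) / 2" if x: "x \<in> carrier_vec 3" for x
    using x by (simp add: cscalar_prod_eq_sum sum_lessThan_3 counterexample_mult_vec)
  show "numerical_radius ?A \<le> 1 / 2"
  proof (rule numerical_radius_least[OF counterexample_carrier])
    show "vec_norm2 (unit_vec 3 0 :: complex vec) = 1" by (simp add: vec_norm2_def)
    fix x :: "complex vec" assume x: "x \<in> carrier_vec 3" "vec_norm2 x = 1"
    have "cmod ((?A *\<^sub>v x) \<bullet>c x) \<le> cmod (x $ Suc 0 * cnj (x $ 0)) + cmod (x $ 2 * cnj (x $ 2) / 2)"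
      unfolding form[OF x(1)] by (rule norm_triangle_ineq)
    also have "\<dots> \<le> (vec_norm2 x)\<^sup>2 / 2"
      using cmod_mult_cnj_le[of "x $ Suc 0" "x $ 0"] cmod_mult_cnj_le[of "x $ 2" "x $ 2"]
      unfolding vec_norm2_sq_3[OF x(1)] norm_divide by simp
    finally show "cmod ((?A *\<^sub>v x) \<bullet>c x) \<le> 1 / 2" using x(2) by simp
  qed simp
  \<comment> \<open>The normalized sum of the first two basis vectors, at which J_2 attains
    1/2.\<close>
  define u :: "complex vec" where "u = vec 3 (\<lambda>i. if i < 2 then complex_of_real (sqrt (1 / 2)) else 0)"
  have u: "u \<in> carrier_vec 3" by (simp add: u_def)
  have "(vec_norm2 u)\<^sup>2 = 1" by (simp add: vec_norm2_sq_3[OF u]) (simp add: u_def)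
  then have u1: "vec_norm2 u = 1" unfolding power2_eq_1_iff using vec_norm2_nonneg[of u] by linarith
  have val: "(?A *\<^sub>v u) \<bullet>c u = 1 / 2"
    unfolding form[OF u] by (simp add: u_def flip: of_real_mult)
  show "1 / 2 \<le> numerical_radius ?A"
    using numerical_radius_upper[OF counterexample_carrier u u1, unfolded val] by simp
qed

text \<open>With a = 1/2, the four terms of the form belong to J_2 tensor J_2, J_2 tensor [a], [a]
  tensor J_2 and [a] tensor [a]. They use the disjoint coordinate sets {0, 4}, {2, 5}, {6, 7} and
  {8}, and none contributes more than half of its share of the squared norm.\<close>

lemma counterexample_kronecker_numerical_radius: "numerical_radius (kronecker counterexample counterexample) = 1 / 2"
proof (rule antisym)
  let ?A = counterexample
  let ?K = "kronecker ?A ?A"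
  have KC: "?K \<in> carrier_mat (3 * 3) (3 * 3)" by (rule kronecker_carrier[OF counterexample_carrier counterexample_carrier])
  have form: "(?K *\<^sub>v z) \<bullet>c z = z $ 4 * cnj (z $ 0) + z $ 5 * cnj (z $ 2) / 2 + z $ 7 * cnj (z $ 6) / 2
      + z $ 8 * cnj (z $ 8) / 4" if z: "z \<in> carrier_vec (3 * 3)" for z
  proof -
    have "(?K *\<^sub>v z) \<bullet>c z = (\<Sum>i<3. \<Sum>j<3. (?K *\<^sub>v z) $ (i * 3 + j) * cnj (z $ (i * 3 + j)))"
      using z by (simp add: cscalar_prod_eq_sum sum_pair_index[of _ 3, simplified])
    also have "\<dots> = (\<Sum>i<3. \<Sum>j<3. (\<Sum>i'<3. \<Sum>j'<3. ?A $$ (i, i') * ?A $$ (j, j') * z $ (i' * 3 + j')) * cnj (z $ (i * 3 + j)))"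
      by (intro sum.cong refl) (simp add: kronecker_mult_vec_index[OF counterexample_carrier counterexample_carrier z])
    also have "\<dots> = z $ 4 * cnj (z $ 0) + z $ 5 * cnj (z $ 2) / 2 + z $ 7 * cnj (z $ 6) / 2
      + z $ 8 * cnj (z $ 8) / 4"
      by (simp add: sum_lessThan_3 counterexample_def del: add_2_eq_Suc')
    finally show ?thesis .
  qed
  have norm: "(vec_norm2 z)\<^sup>2 = (cmod (z $ 0))\<^sup>2 + (cmod (z $ Suc 0))\<^sup>2 + (cmod (z $ 2))\<^sup>2 + (cmod (z $ 3))\<^sup>2
     + (cmod (z $ 4))\<^sup>2 + (cmod (z $ 5))\<^sup>2 + (cmod (z $ 6))\<^sup>2 + (cmod (z $ 7))\<^sup>2 + (cmod (z $ 8))\<^sup>2"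
    if z: "z \<in> carrier_vec (3 * 3)" for z
    unfolding vec_norm2_sq_pair[OF z] by (simp add: sum_lessThan_3 del: add_2_eq_Suc')
  show "numerical_radius ?K \<le> 1 / 2"
  proof (rule numerical_radius_least[OF KC])
    show "vec_norm2 (unit_vec (3 * 3) 0 :: complex vec) = 1" by (simp add: vec_norm2_def)
    fix z :: "complex vec" assume z: "z \<in> carrier_vec (3 * 3)" "vec_norm2 z = 1"
    have "cmod ((?K *\<^sub>v z) \<bullet>c z) \<le> cmod (z $ 4 * cnj (z $ 0)) + cmod (z $ 5 * cnj (z $ 2) / 2)
        + cmod (z $ 7 * cnj (z $ 6) / 2) + cmod (z $ 8 * cnj (z $ 8) / 4)"
      unfolding form[OF z(1)] by (intro norm_triangle_le add_mono order_refl)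
    also have "\<dots> \<le> (vec_norm2 z)\<^sup>2 / 2"
      using cmod_mult_cnj_le[of "z $ 4" "z $ 0"] cmod_mult_cnj_le[of "z $ 5" "z $ 2"]
        cmod_mult_cnj_le[of "z $ 7" "z $ 6"] cmod_mult_cnj_le[of "z $ 8" "z $ 8"]
        zero_le_power2[of "cmod (z $ Suc 0)"] zero_le_power2[of "cmod (z $ 2)"] zero_le_power2[of "cmod (z $ 3)"]
        zero_le_power2[of "cmod (z $ 5)"] zero_le_power2[of "cmod (z $ 6)"] zero_le_power2[of "cmod (z $ 7)"]
        zero_le_power2[of "cmod (z $ 8)"]
      unfolding norm[OF z(1)] norm_divide norm_numeral add_divide_distrib by linarith
    finally show "cmod ((?K *\<^sub>v z) \<bullet>c z) \<le> 1 / 2" using z(2) by simp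
  qed simp
  \<comment> \<open>Coordinates 0 and 4 = 1 * 3 + 1 are e_0 tensor e_0 and e_1 tensor e_1, the pair
    on which J_2 tensor J_2 acts as a copy of J_2.\<close>
  define u :: "complex vec" where "u = vec (3 * 3) (\<lambda>i. if i = 0 \<or> i = 4 then complex_of_real (sqrt (1 / 2)) else 0)"
  have u: "u \<in> carrier_vec (3 * 3)" by (simp add: u_def)
  have "(vec_norm2 u)\<^sup>2 = 1" unfolding norm[OF u] by (simp add: u_def)
  then have u1: "vec_norm2 u = 1" unfolding power2_eq_1_iff using vec_norm2_nonneg[of u] by linarith
  have val: "(?K *\<^sub>v u) \<bullet>c u = 1 / 2"
    unfolding form[OF u] by (simp add: u_def flip: of_real_mult)
  show "1 / 2 \<le> numerical_radius ?K"
    using numerical_radius_upper[OF KC u u1, unfolded val] by simp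
qed

theorem theorem2p13:
  shows
    "(\<forall>(n::nat) (A::complex mat). A \<in> carrier_mat n n \<and> op_norm A = 1 \<longrightarrow>
        (norm_power_index A = nonzero_power_index A \<longleftrightarrow>
           has_unitary_part A \<or>
           (\<exists>(k::nat) (B::complex mat).
              norm_power_index A = enat k \<and> k + 1 \<le> n \<and>
              B \<in> carrier_mat (n - k - 1) (n - k - 1) \<and>
              B ^\<^sub>m (k + 1) = 0\<^sub>m (n - k - 1) (n - k - 1) \<and>
              unitarily_similar A (diag_block_mat [jordan_block (k + 1) 0, B]))))
     \<and>
     (\<forall>(n::nat) (A::complex mat). A \<in> carrier_mat n n \<and> op_norm A = 1 \<and>
        norm_power_index A = nonzero_power_index A \<longrightarrow>
        numerical_radius (kronecker A A) = numerical_radius A)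
     \<and>
     (\<exists>(n::nat) (A::complex mat). A \<in> carrier_mat n n \<and> op_norm A = 1 \<and>
        numerical_radius (kronecker A A) = numerical_radius A \<and>
        norm_power_index A \<noteq> nonzero_power_index A)"
proof (intro conjI allI impI)
  fix n :: nat and A :: "complex mat"
  assume "A \<in> carrier_mat n n \<and> op_norm A = 1"
  then interpret norm_one_mat n A by unfold_locales auto
  show "norm_power_index A = nonzero_power_index A \<longleftrightarrow>
           has_unitary_part A \<or>
           (\<exists>(k::nat) (B::complex mat).
              norm_power_index A = enat k \<and> k + 1 \<le> n \<and>
              B \<in> carrier_mat (n - k - 1) (n - k - 1) \<and>
              B ^\<^sub>m (k + 1) = 0\<^sub>m (n - k - 1) (n - k - 1) \<and>
              unitarily_similar A (diag_block_mat [jordan_block (k + 1) 0, B]))"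
    by (rule indices_eq_iff)
next
  fix n :: nat and A :: "complex mat"
  assume *: "A \<in> carrier_mat n n \<and> op_norm A = 1 \<and> norm_power_index A = nonzero_power_index A"
  then interpret norm_one_mat n A by unfold_locales auto
  show "numerical_radius (kronecker A A) = numerical_radius A"
    using * by (intro numerical_radius_kronecker) blast
next
  show "\<exists>(n::nat) (A::complex mat). A \<in> carrier_mat n n \<and> op_norm A = 1 \<and>
        numerical_radius (kronecker A A) = numerical_radius A \<and>
        norm_power_index A \<noteq> nonzero_power_index A"
    using counterexample_carrier counterexample_op_norm counterexample_numerical_radius
      counterexample_kronecker_numerical_radius counterexample_indices
    by (intro exI[of _ 3] exI[of _ counterexample]) simp
qed

end
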